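(* Let $(\mathfrak g,g,J)$ be a $2n$-dimensional almost Abelian SKT Lie algebra. Then there are $a\in\mathbb R$ and $z=(z_1,\dots,z_{n-1})$, $w=(w_1,\dots,w_{n-1})\in\mathbb C^{n-1}$ with $\operatorname{Re}(z_i)\in\{0,-a/2\}$ for $i=1,\dots,n-1$ such that $(\mathfrak g,g,J)$ is isomorphic (as an almost Hermitian Lie algebra) to $\mathfrak g_{a,z,w}$. Conversely, for all such $a,z,w$ the almost Hermitian Lie algebra $\mathfrak g_{a,z,w}$ is an almost Abelian SKT Lie algebra.
   Context: An almost Hermitian Lie algebra $(\mathfrak g,g,J)$ is a finite-dimensional real Lie algebra with an inner product $g$ and an endomorphism $J$, $J^2=-\mathrm{id}$, with $g(JX,JY)=g(X,Y)$; put $\sigma=g(J\cdot,\cdot)$. Isomorphisms of almost Hermitian Lie algebras are Lie algebra isomorphisms preserving $g$ and $J$. $(\mathfrak g,g,J)$ is SKT if $J$ is integrable ($[JX,JY]-J[JX,Y]-J[X,JY]-[X,Y]=0$ for all $X,Y$) and $d(J^*d\sigma)=0$, where $d$ is the Chevalley–Eilenberg differential and $(J^*\beta)(X_1,\dots,X_k)=\beta(JX_1,\dots,JX_k)$. A Lie algebra is almost Abelian if it has an Abelian ideal of codimension one. For $a\in\mathbb R$, $z,w\in\mathbb C^{n-1}$, $\mathfrak g_{a,z,w}$ is the following almost Hermitian Lie algebra. As a vector space $\mathfrak g_{a,z,w}=\mathfrak a_J\oplus\mathbb R X\oplus\mathbb R\,I_0X$, where $\mathfrak a_J$ is an $(n-1)$-dimensional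 complex vector space with basis $Y_1,\dots,Y_{n-1}$. The almost complex structure $I$ is multiplication by $i$ on $\mathfrak a_J$, and $IX=I_0X$, $I(I_0X)=-X$. The metric is the one for which $Y_1,\dots,Y_{n-1},iY_1,\dots,iY_{n-1},X,I_0X$ is orthonormal. The only non-zero brackets (up to anti-symmetry and complex-linear extension in the argument in $\mathfrak a_J$) are $[I_0X,Y_i]=z_iY_i$ for $i=1,\dots,n-1$ and $[I_0X,X]=aX+\sum_{i=1}^{n-1}w_iY_i$. *)

theory Defs
  imports "HOL-Analysis.Analysis" "HOL-Analysis.Finite_Function_Topology"
begin

text \<open>
  The Lie algebras have varying dimension, so the underlying vector space is an explicit
  finite-dimensional subspace of an arbitrary real vector space, and all structure
  maps matter only on that subspace.
\<close>

record 'v herm_data =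
  vspace :: "'v set"
  bracket :: "'v \<Rightarrow> 'v \<Rightarrow> 'v"
  metric :: "'v \<Rightarrow> 'v \<Rightarrow> real"
  acs :: "'v \<Rightarrow> 'v"

definition lin_on :: "'v::real_vector set \<Rightarrow> ('v \<Rightarrow> 'w::real_vector) \<Rightarrow> bool" where
  "lin_on V f \<longleftrightarrow>
     (\<forall>x\<in>V. \<forall>y\<in>V. f (x + y) = f x + f y) \<and>
     (\<forall>c. \<forall>x\<in>V. f (c *\<^sub>R x) = c *\<^sub>R f x)"

definition bilin_on :: "'v::real_vector set \<Rightarrow> ('v \<Rightarrow> 'v \<Rightarrow> 'w::real_vector) \<Rightarrow> bool" where
  "bilin_on V f \<longleftrightarrow>
     (\<forall>x\<in>V. lin_on V (\<lambda>y. f x y)) \<and> (\<forall>y\<in>V. lin_on V (\<lambda>x. f x y))"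

definition lie_algebra_on :: "'v::real_vector set \<Rightarrow> ('v \<Rightarrow> 'v \<Rightarrow> 'v) \<Rightarrow> bool" where
  "lie_algebra_on V br \<longleftrightarrow>
     subspace V \<and>
     (\<forall>x\<in>V. \<forall>y\<in>V. br x y \<in> V) \<and>
     bilin_on V br \<and>
     (\<forall>x\<in>V. br x x = 0) \<and>
     (\<forall>x\<in>V. \<forall>y\<in>V. \<forall>z\<in>V. br x (br y z) + br y (br z x) + br z (br x y) = 0)"

definition inner_product_on :: "'v::real_vector set \<Rightarrow> ('v \<Rightarrow> 'v \<Rightarrow> real) \<Rightarrow> bool" where
  "inner_product_on V g \<longleftrightarrow>
     bilin_on V g \<and>
     (\<forall>x\<in>V. \<forall>y\<in>V. g x y = g y x) \<and>
     (\<forall>x\<in>V. x \<noteq> 0 \<longrightarrow> g x x > 0)"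

definition almost_hermitian_lie_algebra :: "('v::real_vector) herm_data \<Rightarrow> bool" where
  "almost_hermitian_lie_algebra L \<longleftrightarrow>
     lie_algebra_on (vspace L) (bracket L) \<and>
     (\<exists>B. finite B \<and> span B = vspace L) \<and>
     inner_product_on (vspace L) (metric L) \<and>
     (\<forall>x\<in>vspace L. acs L x \<in> vspace L) \<and>
     lin_on (vspace L) (acs L) \<and>
     (\<forall>x\<in>vspace L. acs L (acs L x) = - x) \<and>
     (\<forall>x\<in>vspace L. \<forall>y\<in>vspace L. metric L (acs L x) (acs L y) = metric L x y)"

definition ah_isomorphic ::
    "('v::real_vector) herm_data \<Rightarrow> ('w::real_vector) herm_data \<Rightarrow> bool" where
  "ah_isomorphic L M \<longleftrightarrow>
     (\<exists>f. bij_betw f (vspace L) (vspace M) \<and>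
          lin_on (vspace L) f \<and>
          (\<forall>x\<in>vspace L. \<forall>y\<in>vspace L. f (bracket L x y) = bracket M (f x) (f y)) \<and>
          (\<forall>x\<in>vspace L. \<forall>y\<in>vspace L. metric M (f x) (f y) = metric L x y) \<and>
          (\<forall>x\<in>vspace L. f (acs L x) = acs M (f x)))"

definition integrable_acs :: "('v::real_vector) herm_data \<Rightarrow> bool" where
  "integrable_acs L \<longleftrightarrow>
     (\<forall>x\<in>vspace L. \<forall>y\<in>vspace L.
        bracket L (acs L x) (acs L y) - acs L (bracket L (acs L x) y)
        - acs L (bracket L x (acs L y)) - bracket L x y = 0)"

text \<open>
  A \<open>k\<close>-form is a function evaluated on argument lists of length \<open>k\<close>.
  On a list \<open>[X\<^sub>0, \<dots>, X\<^sub>k]\<close> the Chevalley--Eilenberg differential of a \<open>k\<close>-form is the sum over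
  \<open>i < j\<close> of \<open>(-1)\<^sup>i\<^sup>+\<^sup>j\<close> times its value on \<open>[X\<^sub>i, X\<^sub>j]\<close> followed by the list
  with \<open>X\<^sub>i\<close> and \<open>X\<^sub>j\<close> removed.
\<close>

definition ce_d :: "('v \<Rightarrow> 'v \<Rightarrow> 'v) \<Rightarrow> ('v list \<Rightarrow> real) \<Rightarrow> 'v list \<Rightarrow> real" where
  "ce_d br \<beta> xs =
     (\<Sum>j<length xs. \<Sum>i<j. (-1) ^ (i + j) * \<beta> (br (xs ! i) (xs ! j) # nths xs (- {i, j})))"

definition pull_form :: "('v \<Rightarrow> 'v) \<Rightarrow> ('v list \<Rightarrow> real) \<Rightarrow> 'v list \<Rightarrow> real" where
  "pull_form J \<beta> xs = \<beta> (map J xs)"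

definition fundamental_form :: "'v herm_data \<Rightarrow> 'v list \<Rightarrow> real" where
  "fundamental_form L xs = metric L (acs L (xs ! 0)) (xs ! 1)"

definition SKT :: "('v::real_vector) herm_data \<Rightarrow> bool" where
  "SKT L \<longleftrightarrow>
     almost_hermitian_lie_algebra L \<and>
     integrable_acs L \<and>
     (\<forall>xs. length xs = 4 \<and> set xs \<subseteq> vspace L \<longrightarrow>
        ce_d (bracket L) (pull_form (acs L) (ce_d (bracket L) (fundamental_form L))) xs = 0)"

definition almost_abelian :: "('v::real_vector) herm_data \<Rightarrow> bool" where
  "almost_abelian L \<longleftrightarrow>
     (\<exists>A. subspace A \<and> A \<subseteq> vspace L \<and>
          (\<forall>x\<in>vspace L. \<forall>y\<in>A. bracket L x y \<in> A) \<and>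
          (\<forall>x\<in>A. \<forall>y\<in>A. bracket L x y = 0) \<and>
          dim A + 1 = dim (vspace L))"

text \<open>
  The model \<open>\<gg>\<^sub>a\<^sub>,\<^sub>z\<^sub>,\<^sub>w\<close>. A pair \<open>(u, t)\<close> with \<open>u\<close> supported in \<open>{1..<n}\<close> stands for
  \<open>(\<Sum>i=1..<n. u\<^sub>i Y\<^sub>i) + Re t X + Im t I\<^sub>0X\<close>.
  The vectors \<open>z\<close> and \<open>w\<close> of \<open>\<complex>\<^sup>n\<^sup>-\<^sup>1\<close> are functions of which only the
  values on \<open>{1..<n}\<close> are used.
\<close>

type_synonym gvec = "(nat \<Rightarrow>\<^sub>0 complex) \<times> complex"

definition Ycomb :: "nat \<Rightarrow> (nat \<Rightarrow> complex) \<Rightarrow> (nat \<Rightarrow>\<^sub>0 complex)" where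
  "Ycomb n c = (\<Sum>i=1..<n. Poly_Mapping.single i (c i))"

text \<open>
  The bracket is the bilinear alternating extension of \<open>[I\<^sub>0X, Y\<^sub>i] = z\<^sub>i Y\<^sub>i\<close> (complex linear
  in \<open>Y\<^sub>i\<close>) and \<open>[I\<^sub>0X, X] = a X + \<Sum>i. w\<^sub>i Y\<^sub>i\<close>.
\<close>

definition g_model :: "nat \<Rightarrow> real \<Rightarrow> (nat \<Rightarrow> complex) \<Rightarrow> (nat \<Rightarrow> complex) \<Rightarrow> gvec herm_data" where
  "g_model n a z w =
     \<lparr> vspace = {(u, t). Poly_Mapping.keys u \<subseteq> {1..<n}},
       bracket = (\<lambda>(u, t) (u', t').
         Im t *\<^sub>R (Ycomb n (\<lambda>i. z i * Poly_Mapping.lookup u' i), 0)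
         - Im t' *\<^sub>R (Ycomb n (\<lambda>i. z i * Poly_Mapping.lookup u i), 0)
         + (Im t * Re t' - Re t * Im t') *\<^sub>R (Ycomb n w, complex_of_real a)),
       metric = (\<lambda>(u, t) (u', t').
         (\<Sum>i=1..<n. Poly_Mapping.lookup u i \<bullet> Poly_Mapping.lookup u' i) + t \<bullet> t'),
       acs = (\<lambda>(u, t). (Ycomb n (\<lambda>i. \<i> * Poly_Mapping.lookup u i), \<i> * t)) \<rparr>"

end

theory Submission
  imports Defs "HOL-Computational_Algebra.Fundamental_Theorem_Algebra"
begin

text \<open>
  Let \<open>u\<close> be a unit normal of the codimension-one Abelian ideal, \<open>X = -Ju\<close>, \<open>D = [u, \<cdot>]\<close>, and let
  \<open>W\<close> be the orthogonal complement of \<open>X\<close> and \<open>u\<close>. Integrability says that \<open>D\<close> maps \<open>W\<close> to itself and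
  is complex linear there. Evaluating \<open>d(J\<^sup>*d\<sigma>)\<close> on \<open>u, X, y, Jy\<close> with \<open>y \<in> W\<close> gives
  \<open>a g(Dy, y) + g(D\<^sup>2y, y) + g(Dy, Dy) = 0\<close>, where \<open>DX\<close> has \<open>X\<close>-component \<open>a\<close>. On an eigenvector with
  eigenvalue \<open>c\<close> this reads \<open>Re c (a + 2 Re c) = 0\<close>. The identity also forces \<open>D\<close> to be unitarily
  diagonalizable on \<open>W\<close>: given orthonormal eigenvectors \<open>e\<^sub>i\<close> with eigenvalues \<open>z\<^sub>i\<close>, take a unit
  eigenvector \<open>v\<close> of the compression of \<open>D\<close> to their orthogonal complement, so
  \<open>Dv = cv + \<Sum> b\<^sub>i e\<^sub>i\<close>. Polarizing the identity at \<open>v\<close> and \<open>e\<^sub>i\<close> yields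
  \<open>(a + c + z\<^sub>i + 2 cnj z\<^sub>i) b\<^sub>i = 0\<close>, while the identity at \<open>v\<close> yields
  \<open>2 (Re c)\<^sup>2 + a Re c = - \<Sum> |b\<^sub>i|\<^sup>2\<close>. If some \<open>b\<^sub>i\<close> were non-zero, then \<open>Re z\<^sub>i \<in> {0, -a/2}\<close>
  would make the left-hand side of the latter equal to \<open>a\<^sup>2\<close>, which is impossible. Hence \<open>v\<close> is an eigenvector of \<open>D\<close>.
\<close>

subsection \<open>Dimension and differential forms\<close>

text \<open>The ambient type may be infinite-dimensional, so a finite spanning set \<open>B\<close>
  is carried along to make bases finite. A basis of \<open>S\<close> stays independent when
  \<open>x\<close> is adjoined.\<close>

lemma dim_insert_finite_span:
  fixes B S :: "'v::real_vector set"
  assumes "finite B" "S \<subseteq> span B" "x \<notin> span S"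
  shows "dim (insert x S) = dim S + 1"
proof -
  obtain C where C: "C \<subseteq> S" "independent C" "S \<subseteq> span C" "card C = dim S"
    using basis_exists by blast
  have fC: "finite C"
    using independent_span_bound[OF assms(1) C(2)] C(1) assms(2) by blast
  have sp: "span C = span S"
    using C(1,3) by (simp add: span_mono span_minimal subset_antisym)
  have "dim (insert x S) = card (insert x C)"
  proof (rule dim_eq_card)
    show "span (insert x C) = span (insert x S)"
      using sp by (simp add: span_insert)
    show "independent (insert x C)"
      using C(2) assms(3) sp by (simp add: independent_insertI)
  qed
  moreover have "x \<notin> C"
    using assms(3) C(1) by (meson span_base subsetD)
  ultimately show ?thesis using fC C(4) by simp
qed

lemma dim_mono_finite_span:
  fixes B S T :: "'v::real_vector set"
  assumes "finite B" "T \<subseteq> span B" "S \<subseteq> T"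
  shows "dim S \<le> dim T"
proof -
  obtain C where C: "C \<subseteq> T" "independent C" "T \<subseteq> span C" "card C = dim T"
    using basis_exists by blast
  have "finite C"
    using independent_span_bound[OF assms(1) C(2)] C(1) assms(2) by blast
  then show ?thesis
    using dim_le_card[of S C] C(3,4) assms(3) by auto
qed

section \<open>Chevalley-Eilenberg differentials of 2-forms and 3-forms\<close>

lemma ce_d_3:
  "ce_d br \<beta> [x, y, z] = - \<beta> [br x y, z] + \<beta> [br x z, y] - \<beta> [br y z, x]"
  by (simp add: ce_d_def numeral_eq_Suc nths_Cons)

lemma ce_d_4:
  "ce_d br \<beta> [x, y, z, w] =
     - \<beta> [br x y, z, w] + \<beta> [br x z, y, w] - \<beta> [br x w, y, z]
     - \<beta> [br y z, x, w] + \<beta> [br y w, x, z] - \<beta> [br z w, x, y]"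
  by (simp add: ce_d_def numeral_eq_Suc nths_Cons)

text \<open>Because \<open>acs L\<close> is an isometry, the \<open>acs L\<close> inside the
  fundamental form cancels against the one applied to the remaining argument.\<close>

lemma pull_d_fundamental_form:
  assumes "almost_hermitian_lie_algebra L" "x \<in> vspace L" "y \<in> vspace L" "z \<in> vspace L"
  shows "pull_form (acs L) (ce_d (bracket L) (fundamental_form L)) [x, y, z] =
    - metric L (bracket L (acs L x) (acs L y)) z + metric L (bracket L (acs L x) (acs L z)) y
    - metric L (bracket L (acs L y) (acs L z)) x"
  using assms
  by (simp add: pull_form_def ce_d_3 fundamental_form_def almost_hermitian_lie_algebra_def
      lie_algebra_on_def)

subsection \<open>The model algebra\<close>

lemma lookup_scaleR [simp]: "Poly_Mapping.lookup (c *\<^sub>R u) i = c *\<^sub>R Poly_Mapping.lookup u i"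
proof -
  have "{i. c *\<^sub>R Poly_Mapping.lookup u i \<noteq> 0} \<subseteq> Poly_Mapping.keys u"
    by (auto simp: in_keys_iff)
  then have "finite {i. c *\<^sub>R Poly_Mapping.lookup u i \<noteq> 0}"
    by (rule finite_subset) simp
  then show ?thesis
    by (simp add: scaleR_poly_mapping_def)
qed

lemma lookup_Ycomb [simp]: "Poly_Mapping.lookup (Ycomb n c) i = (if i \<in> {1..<n} then c i else 0)"
proof -
  have "Poly_Mapping.lookup (Ycomb n c) i = (\<Sum>j=1..<n. if j = i then c j else 0)"
    by (simp add: Ycomb_def lookup_sum lookup_single when_def)
  then show ?thesis by (simp add: sum.delta)
qed

context
  fixes n :: nat and a :: real and z w :: "nat \<Rightarrow> complex"
begin

private abbreviation "M \<equiv> g_model n a z w"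

private abbreviation coord :: "gvec \<Rightarrow> nat \<Rightarrow> complex" where
  "coord u i \<equiv> Poly_Mapping.lookup (fst u) i"

section \<open>Coordinates of the model\<close>

lemma vspace_g_model:
  "u \<in> vspace M \<longleftrightarrow> (\<forall>i. i \<notin> {1..<n} \<longrightarrow> coord u i = 0)"
  by (auto simp: g_model_def in_keys_iff split_beta subset_iff)

text \<open>Reduces vector identities in the model to finitely many identities between complex
  numbers; the Lie algebra axioms and integrability are all checked this way.\<close>

lemma gvec_eqI:
  assumes "u \<in> vspace M" "v \<in> vspace M" "\<And>i. i \<in> {1..<n} \<Longrightarrow> coord u i = coord v i" "snd u = snd v"
  shows "u = v"
  using assms unfolding vspace_g_model by (metis prod_eqI poly_mapping_eqI)

lemma coord_bracket [simp]:
  "coord (bracket M u v) i = (if i \<in> {1..<n} then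
     Im (snd u) *\<^sub>R (z i * coord v i) - Im (snd v) *\<^sub>R (z i * coord u i)
     + (Im (snd u) * Re (snd v) - Re (snd u) * Im (snd v)) *\<^sub>R w i else 0)"
  by (simp add: g_model_def split_beta lookup_add lookup_minus)

lemma snd_bracket [simp]:
  "snd (bracket M u v) = of_real ((Im (snd u) * Re (snd v) - Re (snd u) * Im (snd v)) * a)"
  by (simp add: g_model_def split_beta scaleR_conv_of_real)

lemma coord_acs [simp]: "coord (acs M u) i = (if i \<in> {1..<n} then \<i> * coord u i else 0)"
  by (simp add: g_model_def split_beta)

lemma snd_acs [simp]: "snd (acs M u) = \<i> * snd u"
  by (simp add: g_model_def split_beta)

lemma metric_g_model: "metric M u v = (\<Sum>i=1..<n. coord u i \<bullet> coord v i) + snd u \<bullet> snd v"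
  by (simp add: g_model_def split_beta)

lemma subspace_g_model: "subspace (vspace M)"
  unfolding subspace_def by (simp add: vspace_g_model lookup_add)

lemma bracket_in_g_model: "bracket M u v \<in> vspace M"
  by (simp add: vspace_g_model)

lemma acs_in_g_model: "acs M u \<in> vspace M"
  by (simp add: vspace_g_model)

lemma finite_span_g_model: "\<exists>B. finite B \<and> span B = vspace M"
proof -
  \<comment> \<open>The real basis of the model: all \<open>Y_i\<close> and \<open>i Y_i\<close>,
    then \<open>X\<close> and \<open>I_0X\<close>.\<close>
  define B :: "gvec set" where
    "B = (\<lambda>(i, c). (Poly_Mapping.single i c, 0)) ` ({1..<n} \<times> {1, \<i>}) \<union> Pair 0 ` {1, \<i>}"
  have "B \<subseteq> vspace M"
    by (auto simp: B_def vspace_g_model lookup_single)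
  moreover have "vspace M \<subseteq> span B"
  proof
    fix u assume u: "u \<in> vspace M"
    define v :: gvec where
      "v = (\<Sum>i=1..<n. Re (coord u i) *\<^sub>R (Poly_Mapping.single i 1, 0)
              + Im (coord u i) *\<^sub>R (Poly_Mapping.single i \<i>, 0))
           + (Re (snd u) *\<^sub>R (0, 1) + Im (snd u) *\<^sub>R (0, \<i>))"
    have v: "v \<in> span B"
      unfolding v_def B_def
      by (intro span_add span_sum span_scale span_base) auto
    have "u = v"
    proof (rule prod_eqI)
      show "fst u = fst v"
      proof (rule poly_mapping_eqI)
        fix i
        have "coord v i = (\<Sum>j=1..<n. Re (coord u j) *\<^sub>R (1 when j = i)
            + Im (coord u j) *\<^sub>R (\<i> when j = i))"
          by (simp add: v_def fst_sum lookup_sum lookup_add lookup_single)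
        also have "\<dots> = (\<Sum>j=1..<n. if j = i then coord u j else 0)"
          by (rule sum.cong) (auto simp: complex_eq_iff)
        finally have "coord v i = (\<Sum>j=1..<n. if j = i then coord u j else 0)" .
        then show "coord u i = coord v i"
          using u by (auto simp: sum.delta vspace_g_model)
      qed
      show "snd u = snd v"
        by (simp add: v_def snd_sum complex_eq_iff)
    qed
    with v show "u \<in> span B" by simp
  qed
  ultimately have "span B = vspace M"
    using subspace_g_model by (simp add: span_minimal subset_antisym)
  moreover have "finite B" by (simp add: B_def)
  ultimately show ?thesis by blast
qed

lemma almost_hermitian_g_model: "almost_hermitian_lie_algebra M"
  unfolding almost_hermitian_lie_algebra_def
proof (intro conjI ballI)
  show "lie_algebra_on (vspace M) (bracket M)"
    unfolding lie_algebra_on_def bilin_on_def lin_on_def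
  proof (intro conjI ballI allI)
    fix u v x assume "u \<in> vspace M" "v \<in> vspace M" "x \<in> vspace M"
    show "bracket M u (bracket M v x) + bracket M v (bracket M x u) + bracket M x (bracket M u v) = 0"
      by (rule gvec_eqI) (auto simp: subspace_g_model subspace_add subspace_0 bracket_in_g_model
          lookup_add complex_eq_iff algebra_simps)
  qed (auto simp: subspace_g_model subspace_add subspace_scale subspace_0 bracket_in_g_model
         lookup_add complex_eq_iff algebra_simps intro!: gvec_eqI)
  show "inner_product_on (vspace M) (metric M)"
    unfolding inner_product_on_def bilin_on_def lin_on_def
  proof (intro conjI ballI allI impI)
    fix u assume u: "u \<in> vspace M" "u \<noteq> 0"
    then consider i where "i \<in> {1..<n}" "coord u i \<noteq> 0" | "snd u \<noteq> 0"
      using gvec_eqI[of u 0] by (auto simp: subspace_g_model subspace_0)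
    then show "metric M u u > 0"
    proof cases
      case (1 i)
      have "0 < (\<Sum>i=1..<n. coord u i \<bullet> coord u i)"
        using 1 by (intro sum_pos2[of _ i]) auto
      then show ?thesis by (simp add: metric_g_model add_pos_nonneg)
    next
      case 2
      then show ?thesis by (simp add: metric_g_model add_nonneg_pos sum_nonneg)
    qed
  qed (auto simp: metric_g_model lookup_add inner_add_left inner_add_right sum.distrib
        sum_distrib_left inner_commute algebra_simps)
  show "lin_on (vspace M) (acs M)"
    unfolding lin_on_def
    by (auto simp: subspace_g_model subspace_add subspace_scale acs_in_g_model lookup_add
        algebra_simps intro!: gvec_eqI)
  show "acs M (acs M u) = - u" if "u \<in> vspace M" for u
    using that by (intro gvec_eqI) (auto simp: subspace_g_model subspace_neg acs_in_g_model
      simp flip: mult.assoc)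
  show "metric M (acs M u) (acs M v) = metric M u v" for u v
    by (auto simp: metric_g_model inner_complex_def intro!: sum.cong)
qed (auto simp: finite_span_g_model acs_in_g_model)

lemma integrable_g_model: "integrable_acs M"
  unfolding integrable_acs_def
  by (auto simp: subspace_g_model subspace_add subspace_diff subspace_0 acs_in_g_model bracket_in_g_model
      lookup_minus lookup_add complex_eq_iff algebra_simps intro!: gvec_eqI)

lemma almost_abelian_g_model: "almost_abelian M"
proof -
  \<comment> \<open>The Abelian ideal is the orthogonal complement of \<open>I_0X\<close>, and
    \<open>x\<close> is \<open>I_0X\<close> itself.\<close>
  define A where "A = {u \<in> vspace M. Im (snd u) = 0}"
  define x :: gvec where "x = (0, \<i>)"
  have A: "subspace A"
    using subspace_g_model by (auto simp: A_def subspace_def)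
  have x: "x \<in> vspace M" "x \<notin> span A"
    using A by (auto simp: x_def A_def vspace_g_model span_eq_iff[THEN iffD2])
  have "vspace M \<subseteq> span (insert x A)"
  proof
    fix u assume u: "u \<in> vspace M"
    then have "u - Im (snd u) *\<^sub>R x \<in> vspace M"
      using x subspace_g_model by (simp add: subspace_diff subspace_scale)
    then have "u - Im (snd u) *\<^sub>R x \<in> A"
      by (simp add: A_def x_def)
    then show "u \<in> span (insert x A)"
      using span_breakdown_eq span_base by blast
  qed
  then have "span (insert x A) = vspace M"
    using x subspace_g_model by (intro subset_antisym span_minimal) (auto simp: A_def)
  moreover obtain B where "finite B" "span B = vspace M"
    using finite_span_g_model by blast
  ultimately have "dim A + 1 = dim (vspace M)"
    using dim_insert_finite_span[of B A x] x by (metis (no_types, lifting) A_def dim_span mem_Collect_eq subsetI)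
  \<comment> \<open>The second component of every bracket is a real multiple of \<open>a\<close>, so
    all brackets lie in \<open>A\<close>.\<close>
  moreover have "bracket M u v \<in> A" for u v
    by (simp add: A_def bracket_in_g_model)
  moreover have "bracket M u v = 0" if "u \<in> A" "v \<in> A" for u v
    using that by (intro gvec_eqI) (auto simp: A_def bracket_in_g_model subspace_0 subspace_g_model)
  ultimately show ?thesis
    using A unfolding almost_abelian_def by (auto simp: A_def)
qed

text \<open>The contribution of coordinate \<open>i\<close> to a 2-form \<open>\<omega>\<close> with
  \<open>J^*d\<sigma> = - \<xi> \<and> \<omega>\<close>, where \<open>\<and>\<close> is the wedge
  product and \<open>\<xi>\<close> is the 1-form dual to \<open>X\<close>, that is, the real part of
  the second component.\<close>

definition model_form :: "nat \<Rightarrow> gvec \<Rightarrow> gvec \<Rightarrow> real" where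
  "model_form i u v = 2 * Re (z i) * ((\<i> * coord u i) \<bullet> coord v i)
     - Im (snd u) * (w i \<bullet> coord v i) + Im (snd v) * (w i \<bullet> coord u i)"

lemma pull_d_fundamental_form_g_model:
  assumes "u \<in> vspace M" "v \<in> vspace M" "x \<in> vspace M"
  shows "pull_form (acs M) (ce_d (bracket M) (fundamental_form M)) [u, v, x] =
    - (\<Sum>i=1..<n. Re (snd u) * model_form i v x + Re (snd v) * model_form i x u
        + Re (snd x) * model_form i u v)"
  unfolding pull_d_fundamental_form[OF almost_hermitian_g_model assms] metric_g_model
  by (simp add: model_form_def sum_negf[symmetric] sum.distrib[symmetric] sum_subtractf[symmetric]
      inner_complex_def algebra_simps cong: sum.cong_simp)

lemma SKT_g_model:
  assumes "\<And>i. i \<in> {1..<n} \<Longrightarrow> Re (z i) \<in> {0, - a / 2}"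
  shows "SKT M"
  unfolding SKT_def
proof (intro conjI allI impI)
  fix xs assume xs: "length xs = 4 \<and> set xs \<subseteq> vspace M"
  then obtain x1 x2 x3 x4 where xs_eq: "xs = [x1, x2, x3, x4]"
    by (auto simp: numeral_eq_Suc length_Suc_conv)
  with xs have V: "x1 \<in> vspace M" "x2 \<in> vspace M" "x3 \<in> vspace M" "x4 \<in> vspace M"
    by auto
  \<comment> \<open>The two allowed values of \<open>Re (z i)\<close> enter only through this
    quadratic relation.\<close>
  have *: "2 * Re (z i) * Re (z i) = - a * Re (z i)" if "i \<in> {1..<n}" for i
    using assms[OF that] by auto
  show "ce_d (bracket M) (pull_form (acs M) (ce_d (bracket M) (fundamental_form M))) xs = 0"
    unfolding xs_eq ce_d_4
    apply (simp add: V bracket_in_g_model pull_d_fundamental_form_g_model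
        sum_negf[symmetric] sum.distrib[symmetric] sum_subtractf[symmetric] del: sum.distrib)
    \<comment> \<open>The coordinates do not interact: the summand of each \<open>i\<close> vanishes
      by itself.\<close>
    apply (rule sum.neutral)
    apply (rule ballI)
    subgoal for i
      using *[of i]
      apply (simp add: model_form_def inner_complex_def)
      apply algebra
      done
    done
qed (auto simp: almost_hermitian_g_model integrable_g_model)

end

subsection \<open>Hermitian spaces and eigenvectors\<close>

text \<open>\<open>card S + 1\<close> distinct vectors in the span of \<open>S\<close> are too many
  to be independent. A repeated vector needs its own case, since the set of values is then smaller
  and may well be independent.\<close>

lemma exists_linear_relation:
  fixes f :: "nat \<Rightarrow> 'v::real_vector"
  assumes "finite S" "\<And>k. f k \<in> span S"
  shows "\<exists>u N. (\<exists>k\<le>N. u k \<noteq> 0) \<and> (\<Sum>k\<le>N. u k *\<^sub>R f k) = 0"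
proof (cases "inj_on f {..card S}")
  case True
  have "dependent (f ` {..card S})"
    using independent_span_bound[OF assms(1), of "f ` {..card S}"] assms(2) card_image[OF True]
    by fastforce
  then obtain u where u: "\<exists>v\<in>f ` {..card S}. u v \<noteq> 0" "(\<Sum>v\<in>f ` {..card S}. u v *\<^sub>R v) = 0"
    by (auto simp: dependent_finite)
  then show ?thesis
    using sum.reindex[OF True, of "\<lambda>v. u v *\<^sub>R v"]
    by (intro exI[of _ "u \<circ> f"] exI[of _ "card S"]) auto
next
  case False
  then obtain i j where ij: "i \<le> card S" "j \<le> card S" "i \<noteq> j" "f i = f j"
    by (auto simp: inj_on_def)
  \<comment> \<open>The relation has coefficient 1 at \<open>i\<close>, -1 at \<open>j\<close> and 0
    elsewhere.\<close>
  have "(\<Sum>k\<le>card S. (of_bool (k = i) - of_bool (k = j)) *\<^sub>R f k) = f i - f j"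
  proof -
    have "(of_bool (k = i) - of_bool (k = j)) *\<^sub>R f k
        = (if k = i then f k else 0) - (if k = j then f k else 0)" for k
      by simp
    then show ?thesis using ij by (simp only: sum_subtractf) (simp add: sum.delta)
  qed
  then show ?thesis
    using ij by (intro exI[of _ "\<lambda>k. of_bool (k = i) - of_bool (k = j)"] exI[of _ "card S"]) auto
qed

text \<open>The linear algebra is developed without a bracket, for an arbitrary operator
  \<open>D\<close>; the Lie algebra enters later through \<open>D = [u, _]\<close>.\<close>

locale hermitian_space =
  fixes V :: "'v::real_vector set" and g :: "'v \<Rightarrow> 'v \<Rightarrow> real" and J :: "'v \<Rightarrow> 'v"
  assumes subspace_V: "subspace V"
    and finite_span: "\<exists>B. finite B \<and> span B = V"
    and inner_product: "inner_product_on V g"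
    and J_in [simp]: "x \<in> V \<Longrightarrow> J x \<in> V"
    and lin_J: "lin_on V J"
    and J_J [simp]: "x \<in> V \<Longrightarrow> J (J x) = - x"
    and g_J_J [simp]: "x \<in> V \<Longrightarrow> y \<in> V \<Longrightarrow> g (J x) (J y) = g x y"
begin

section \<open>Calculus of the metric and the complex structure\<close>

lemma V_closed [simp]:
  "0 \<in> V" "x \<in> V \<Longrightarrow> y \<in> V \<Longrightarrow> x + y \<in> V" "x \<in> V \<Longrightarrow> y \<in> V \<Longrightarrow> x - y \<in> V"
  "x \<in> V \<Longrightarrow> r *\<^sub>R x \<in> V" "x \<in> V \<Longrightarrow> - x \<in> V"
  using subspace_V by (auto simp: subspace_0 subspace_add subspace_diff subspace_scale subspace_neg)

lemma J_linear [simp]: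
  "x \<in> V \<Longrightarrow> y \<in> V \<Longrightarrow> J (x + y) = J x + J y" "x \<in> V \<Longrightarrow> J (r *\<^sub>R x) = r *\<^sub>R J x"
  using lin_J by (auto simp: lin_on_def)

lemma J_0 [simp]: "J 0 = 0"
  using J_linear(2)[of 0 0] by simp

lemma J_minus [simp]: "x \<in> V \<Longrightarrow> J (- x) = - J x"
  using J_linear(2)[of x "-1"] by simp

lemma J_diff [simp]: "x \<in> V \<Longrightarrow> y \<in> V \<Longrightarrow> J (x - y) = J x - J y"
  using J_linear(1)[of x "- y"] by simp

lemma g_left [simp]:
  "x \<in> V \<Longrightarrow> y \<in> V \<Longrightarrow> z \<in> V \<Longrightarrow> g (x + y) z = g x z + g y z"
  "x \<in> V \<Longrightarrow> z \<in> V \<Longrightarrow> g (r *\<^sub>R x) z = r * g x z"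
  using inner_product by (auto simp: inner_product_on_def bilin_on_def lin_on_def)

lemma g_commute: "x \<in> V \<Longrightarrow> y \<in> V \<Longrightarrow> g x y = g y x"
  using inner_product by (auto simp: inner_product_on_def)

lemma g_minus_left [simp]: "x \<in> V \<Longrightarrow> y \<in> V \<Longrightarrow> g (- x) y = - g x y"
  using g_left(2)[of x y "-1"] by simp

lemma g_0_left [simp]: "y \<in> V \<Longrightarrow> g 0 y = 0"
  using g_left(2)[of 0 y 0] by simp

lemma g_diff_left [simp]: "x \<in> V \<Longrightarrow> y \<in> V \<Longrightarrow> z \<in> V \<Longrightarrow> g (x - y) z = g x z - g y z"
  using g_left(1)[of x "- y" z] by simp

lemma g_right [simp]:
  "x \<in> V \<Longrightarrow> y \<in> V \<Longrightarrow> z \<in> V \<Longrightarrow> g z (x + y) = g z x + g z y"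
  "x \<in> V \<Longrightarrow> z \<in> V \<Longrightarrow> g z (r *\<^sub>R x) = r * g z x"
  "x \<in> V \<Longrightarrow> z \<in> V \<Longrightarrow> g z (- x) = - g z x"
  by (simp_all add: g_commute[of z])

lemma g_0_right [simp]: "y \<in> V \<Longrightarrow> g y 0 = 0"
  using g_right(2)[of 0 y 0] by simp

lemma g_diff_right [simp]: "x \<in> V \<Longrightarrow> y \<in> V \<Longrightarrow> z \<in> V \<Longrightarrow> g z (x - y) = g z x - g z y"
  using g_right(1)[of x "- y" z] by (simp add: g_right(3))

lemma g_pos: "x \<in> V \<Longrightarrow> x \<noteq> 0 \<Longrightarrow> g x x > 0"
  using inner_product by (auto simp: inner_product_on_def)

lemma g_J_right: "x \<in> V \<Longrightarrow> y \<in> V \<Longrightarrow> g x (J y) = - g (J x) y"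
  using g_J_J[of x "J y"] by simp

lemma g_J_self [simp]: "x \<in> V \<Longrightarrow> g x (J x) = 0" "x \<in> V \<Longrightarrow> g (J x) x = 0"
  using g_J_right[of x x] g_commute[of x "J x"] by auto

text \<open>Complex scalar multiplication on \<open>V\<close>, with \<open>J\<close> acting as the
  imaginary unit.\<close>

definition cs :: "complex \<Rightarrow> 'v \<Rightarrow> 'v" where
  "cs c x = Re c *\<^sub>R x + Im c *\<^sub>R J x"

text \<open>The Hermitian form with real part \<open>g\<close>, complex linear in the first argument
  and conjugate linear in the second.\<close>

definition h :: "'v \<Rightarrow> 'v \<Rightarrow> complex" where
  "h x y = Complex (g x y) (g x (J y))"

lemma cs_in [simp]: "x \<in> V \<Longrightarrow> cs c x \<in> V"
  by (simp add: cs_def)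

lemma cs_add: "cs (c + d) x = cs c x + cs d x"
  by (simp add: cs_def algebra_simps)

lemma cs_right_add: "x \<in> V \<Longrightarrow> y \<in> V \<Longrightarrow> cs c (x + y) = cs c x + cs c y"
  by (simp add: cs_def algebra_simps)

lemma cs_cs [simp]: "x \<in> V \<Longrightarrow> cs c (cs d x) = cs (c * d) x"
  by (simp add: cs_def algebra_simps)

lemma cs_simps [simp]: "cs 0 x = 0" "cs 1 x = x" "cs \<i> x = J x" "cs c 0 = 0"
  "cs (of_real r) x = r *\<^sub>R x"
  by (simp_all add: cs_def)

lemma cs_minus: "cs (- c) x = - cs c x"
  by (simp add: cs_def)

lemma cs_eq_0_iff: "x \<in> V \<Longrightarrow> cs c x = 0 \<longleftrightarrow> c = 0 \<or> x = 0"
  by (metis cs_cs cs_simps(1,2,4) left_inverse)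

lemma Re_h [simp]: "Re (h x y) = g x y"
  by (simp add: h_def)

lemma h_left [simp]:
  "x \<in> V \<Longrightarrow> y \<in> V \<Longrightarrow> z \<in> V \<Longrightarrow> h (x + y) z = h x z + h y z"
  "x \<in> V \<Longrightarrow> y \<in> V \<Longrightarrow> h (cs c x) y = c * h x y"
  by (auto simp: h_def cs_def complex_eq_iff g_J_right algebra_simps)

lemma h_commute: "x \<in> V \<Longrightarrow> y \<in> V \<Longrightarrow> h x y = cnj (h y x)"
  by (metis (no_types, lifting) J_in complex_cnj g_J_right g_commute h_def)

lemma h_right [simp]:
  assumes "x \<in> V" "y \<in> V" "z \<in> V"
  shows "h z (x + y) = h z x + h z y" "h y (cs c x) = cnj c * h y x"
  using assms h_commute[of z "x + y"] h_commute[of z x] h_commute[of z y]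
    h_commute[of y "cs c x"] h_commute[of y x]
  by (simp_all only: h_left V_closed cs_in complex_cnj_add complex_cnj_mult)

lemma h_J_left [simp]: "x \<in> V \<Longrightarrow> y \<in> V \<Longrightarrow> h (J x) y = \<i> * h x y"
  using h_left(2)[of x y \<i>] by simp

lemma h_scaleR_left [simp]: "x \<in> V \<Longrightarrow> y \<in> V \<Longrightarrow> h (r *\<^sub>R x) y = of_real r * h x y"
  using h_left(2)[of x y "of_real r"] by simp

lemma h_minus_left [simp]: "x \<in> V \<Longrightarrow> y \<in> V \<Longrightarrow> h (- x) y = - h x y"
  using h_scaleR_left[of x y "-1"] by simp

lemma h_0_left [simp]: "y \<in> V \<Longrightarrow> h 0 y = 0"
  using h_scaleR_left[of 0 y 0] by simp

lemma h_diff_left [simp]: "x \<in> V \<Longrightarrow> y \<in> V \<Longrightarrow> z \<in> V \<Longrightarrow> h (x - y) z = h x z - h y z"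
  using h_left(1)[of x "- y" z] by simp

lemma h_self: "x \<in> V \<Longrightarrow> h x x = of_real (g x x)"
  by (simp add: h_def complex_eq_iff)

lemma V_sum [simp]: "(\<And>i. i \<in> I \<Longrightarrow> f i \<in> V) \<Longrightarrow> sum f I \<in> V"
  using subspace_V by (rule subspace_sum)

lemma h_sum_left: "(\<And>i. i \<in> I \<Longrightarrow> f i \<in> V) \<Longrightarrow> y \<in> V \<Longrightarrow> h (sum f I) y = (\<Sum>i\<in>I. h (f i) y)"
  by (induction I rule: infinite_finite_induct) auto

lemma h_sum_right: "(\<And>i. i \<in> I \<Longrightarrow> f i \<in> V) \<Longrightarrow> y \<in> V \<Longrightarrow> h y (sum f I) = (\<Sum>i\<in>I. h y (f i))"
  by (subst h_commute) (auto simp: h_sum_left intro!: sum.cong intro: h_commute[symmetric])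

section \<open>Orthogonality and projections\<close>

lemma orthogonal_span:
  assumes "x \<in> V" "S \<subseteq> V" "\<And>s. s \<in> S \<Longrightarrow> g x s = 0" "y \<in> span S"
  shows "g x y = 0"
proof -
  have "subspace {y \<in> V. g x y = 0}"
    using assms(1) g_commute[OF assms(1) V_closed(1)] by (auto simp: subspace_def)
  then have "span S \<subseteq> {y \<in> V. g x y = 0}"
    using assms(2,3) by (intro span_minimal) auto
  then show ?thesis using assms(4) by auto
qed

lemma not_in_span_if_orthogonal:
  assumes "x \<in> V" "x \<noteq> 0" "S \<subseteq> V" "\<And>s. s \<in> S \<Longrightarrow> g x s = 0"
  shows "x \<notin> span S"
  using orthogonal_span[OF assms(1,3,4), of x] g_pos[of x] assms(1,2) by auto

text \<open>A Gram-Schmidt step: \<open>b - b0\<close> is the part of \<open>b\<close> orthogonal to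
  \<open>S\<close>, so correcting \<open>y\<close> along it makes the remainder orthogonal to
  \<open>b\<close> without disturbing orthogonality to \<open>S\<close>.\<close>

lemma exists_orthogonal_projection:
  assumes "finite S" "S \<subseteq> V" "x \<in> V"
  shows "\<exists>y\<in>span S. \<forall>s\<in>S. g (x - y) s = 0"
  using assms
proof (induction S arbitrary: x rule: finite_induct)
  case empty
  then show ?case by simp
next
  case (insert b S)
  have span_V: "span S \<subseteq> V"
    using insert.prems subspace_V by (simp add: span_minimal)
  obtain y where y: "y \<in> span S" "\<forall>s\<in>S. g (x - y) s = 0"
    using insert by blast
  obtain b0 where b0: "b0 \<in> span S" "\<forall>s\<in>S. g (b - b0) s = 0"
    using insert by blast
  have V: "x \<in> V" "y \<in> V" "b \<in> V" "b0 \<in> V" "S \<subseteq> V"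
    using insert.prems y b0 span_V by auto
  define c where "c = g (x - y) (b - b0) / g (b - b0) (b - b0)" \<comment> \<open>\<open>0\<close> if \<open>b \<in> span S\<close>\<close>
  define y' where "y' = y + c *\<^sub>R (b - b0)"
  have V': "y' \<in> V"
    using V by (simp add: y'_def)
  have in_span: "y' \<in> span (insert b S)"
  proof -
    have "y \<in> span (insert b S)" "b0 \<in> span (insert b S)"
      using y b0 span_mono[of S "insert b S"] by auto
    then show ?thesis
      unfolding y'_def by (intro span_add span_scale span_diff) (auto intro: span_base)
  qed
  have S: "g (x - y') s = 0" if "s \<in> S" for s
  proof -
    have "x - y' = (x - y) - c *\<^sub>R (b - b0)" by (simp add: y'_def)
    moreover have "s \<in> V" using that V by auto
    ultimately have "g (x - y') s = g (x - y) s - c * g (b - b0) s"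
      using V by (simp only: g_diff_left[of "x - y"] g_left(2) V_closed)
    then show ?thesis using y(2) b0(2) that by simp
  qed
  have b: "g (x - y') b = 0"
  proof -
    have "g (x - y') b0 = 0"
      by (rule orthogonal_span[OF _ V(5) S b0(1)]) (use V V' in simp_all)
    then have "g (x - y') b = g (x - y') (b - b0)"
      using V V' by (simp only: g_diff_right V_closed diff_zero)
    also have "g (x - y') (b - b0) = g (x - y) (b - b0) - c * g (b - b0) (b - b0)"
      using V unfolding y'_def diff_diff_eq[symmetric] by (simp only: g_diff_left[of "x - y"] g_left(2) V_closed)
    also have "\<dots> = 0"
    proof (cases "b - b0 = 0")
      case True
      show ?thesis using V unfolding True by (simp only: g_0_right V_closed)
    next
      case False
      then have "g (b - b0) (b - b0) > 0" using V by (intro g_pos V_closed)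
      then show ?thesis by (simp add: c_def)
    qed
    finally show ?thesis .
  qed
  show ?case
    using S b in_span by (intro bexI[of _ y']) auto
qed

text \<open>\<open>D\<close> acts as a complex linear endomorphism of the complex subspace
  \<open>W\<close>. Nothing is demanded outside \<open>W\<close>: the operator \<open>[u, _]\<close>
  is shown to commute with \<open>J\<close> only there.\<close>

definition invariant :: "'v set \<Rightarrow> ('v \<Rightarrow> 'v) \<Rightarrow> bool" where
  "invariant W D \<longleftrightarrow> subspace W \<and> W \<subseteq> V \<and> (\<forall>x\<in>W. J x \<in> W) \<and> (\<forall>x\<in>W. D x \<in> W)
     \<and> lin_on W D \<and> (\<forall>x\<in>W. D (J x) = J (D x))"

lemma invariant_cs_in: "invariant W D \<Longrightarrow> x \<in> W \<Longrightarrow> cs c x \<in> W"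
  by (simp add: invariant_def cs_def subspace_add subspace_scale)

lemma invariant_cs: "invariant W D \<Longrightarrow> x \<in> W \<Longrightarrow> D (cs c x) = cs c (D x)"
  by (simp add: invariant_def cs_def subspace_scale lin_on_def)

lemma invariant_add: "invariant W D \<Longrightarrow> x \<in> W \<Longrightarrow> y \<in> W \<Longrightarrow> D (x + y) = D x + D y"
  by (simp add: invariant_def lin_on_def)

lemma invariant_0: "invariant W D \<Longrightarrow> D 0 = 0"
  using invariant_cs[of W D 0 0] by (auto simp: invariant_def subspace_0)

lemma invariant_sum:
  assumes "invariant W D" "\<And>i. i \<in> I \<Longrightarrow> f i \<in> W"
  shows "D (sum f I) = (\<Sum>i\<in>I. D (f i))"
  using assms(2)
proof (induction I rule: infinite_finite_induct)
  case (insert x F)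
  moreover have "sum f F \<in> W"
    using assms(1) insert.prems by (auto simp: invariant_def intro!: subspace_sum)
  ultimately show ?case using invariant_add[OF assms(1)] by simp
qed (use invariant_0[OF assms(1)] in auto)

lemma invariant_funpow_in: "invariant W D \<Longrightarrow> x \<in> W \<Longrightarrow> (D ^^ k) x \<in> W"
  by (induction k) (auto simp: invariant_def)

text \<open>Powers of \<open>D\<close> commute with \<open>D + c\<close>; this is what allows a
  linear factor to be split off a polynomial in \<open>D\<close>.\<close>

lemma invariant_funpow_shift:
  assumes "invariant W D" "x \<in> W"
  shows "(D ^^ k) (D x + cs c x) = (D ^^ Suc k) x + cs c ((D ^^ k) x)"
proof (induction k)
  case 0
  then show ?case by simp
next
  case (Suc k)
  have in_W: "(D ^^ k) x \<in> W" for k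
    by (rule invariant_funpow_in[OF assms])
  have "(D ^^ Suc k) (D x + cs c x) = D ((D ^^ Suc k) x + cs c ((D ^^ k) x))"
    using Suc by simp
  also have "\<dots> = D ((D ^^ Suc k) x) + cs c (D ((D ^^ k) x))"
    using in_W invariant_cs_in[OF assms(1)] by (simp only: invariant_add[OF assms(1)] invariant_cs[OF assms(1)])
  finally show ?case by simp
qed

text \<open>Write \<open>p = (T - c) q\<close> with \<open>c\<close> a root. Either
  \<open>(D - c) x = 0\<close> and \<open>x\<close> is an eigenvector, or \<open>q\<close>
  annihilates the non-zero vector \<open>(D - c) x\<close> and has smaller degree. A non-zero
  constant cannot annihilate \<open>x\<close>.\<close>

lemma eigenvector_of_annihilating_poly:
  assumes "invariant W D" "degree p \<le> N" "p \<noteq> 0" "x \<in> W" "x \<noteq> 0"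
    "(\<Sum>k\<le>N. cs (coeff p k) ((D ^^ k) x)) = 0"
  shows "\<exists>v\<in>W. v \<noteq> 0 \<and> (\<exists>c. D v = cs c v)"
  using assms(2-)
proof (induction N arbitrary: p x)
  case 0
  then have "coeff p 0 \<noteq> 0" by (metis le_zero_eq leading_coeff_0_iff)
  then show ?case
    using 0 assms(1) cs_eq_0_iff[of x "coeff p 0"] by (auto simp: invariant_def)
next
  case (Suc N)
  have WV: "W \<subseteq> V" using assms(1) by (simp add: invariant_def)
  note pow_V = subsetD[OF WV invariant_funpow_in[OF assms(1)]]
  show ?case
  proof (cases "degree p = 0")
    case True
    then have "coeff p 0 \<noteq> 0" using Suc.prems by (metis leading_coeff_0_iff)
    moreover have "(\<Sum>k\<le>Suc N. cs (coeff p k) ((D ^^ k) x)) = cs (coeff p 0) x"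
      using True by (subst sum.atMost_Suc_shift) (simp add: coeff_eq_0)
    ultimately show ?thesis
      using Suc.prems WV cs_eq_0_iff[of x "coeff p 0"] by auto
  next
    case False
    then obtain c where "poly p c = 0"
      using fundamental_theorem_of_algebra[of p] constant_degree[of p] by auto
    then obtain q where q: "p = [:- c, 1:] * q"
      by (metis dvd_def poly_eq_0_iff_dvd)
    have "q \<noteq> 0" using q Suc.prems by auto
    then have deg_q: "degree q \<le> N"
      using Suc.prems(1) unfolding q by (subst (asm) degree_mult_eq) auto
    define y where "y = D x + cs (- c) x"
    show ?thesis
    proof (cases "y = 0")
      case True
      then show ?thesis
        using Suc.prems by (auto simp: y_def cs_minus intro!: bexI[of _ x] exI[of _ c])
    next
      case False
      have y_in: "y \<in> W"
        using assms(1) Suc.prems(3) invariant_cs_in[OF assms(1)]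
        by (auto simp: y_def invariant_def subspace_add)
      have coeffs: "coeff p 0 = - c * coeff q 0" "coeff p (Suc k) = coeff q k - c * coeff q (Suc k)" for k
        by (simp_all add: q)
      let ?x = "\<lambda>k. (D ^^ k) x"
      have "(\<Sum>k\<le>N. cs (coeff q k) ((D ^^ k) y))
          = (\<Sum>k\<le>N. cs (coeff q k) (?x (Suc k))) + (\<Sum>k\<le>N. cs (- c * coeff q k) (?x k))"
        unfolding y_def invariant_funpow_shift[OF assms(1) Suc.prems(3)] sum.distrib[symmetric]
        using pow_V[OF Suc.prems(3)] pow_V[OF Suc.prems(3), of "Suc _"]
        by (intro sum.cong) (auto simp: cs_right_add mult.commute simp del: funpow.simps)
      \<comment> \<open>The added top term is zero because \<open>degree q \<le> N\<close>; it makes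
        the index shift match the coefficients of \<open>p\<close>.\<close>
      also have "(\<Sum>k\<le>N. cs (- c * coeff q k) (?x k)) = (\<Sum>k\<le>Suc N. cs (- c * coeff q k) (?x k))"
        using deg_q by (simp add: coeff_eq_0)
      also have "\<dots> = cs (coeff p 0) (?x 0) + (\<Sum>k\<le>N. cs (- c * coeff q (Suc k)) (?x (Suc k)))"
        by (subst sum.atMost_Suc_shift) (simp add: coeffs)
      also have "(\<Sum>k\<le>N. cs (coeff q k) (?x (Suc k))) + \<dots>
          = cs (coeff p 0) (?x 0) + (\<Sum>k\<le>N. cs (coeff p (Suc k)) (?x (Suc k)))"
        by (simp only: coeffs diff_conv_add_uminus cs_add sum.distrib) (simp add: algebra_simps)
      also have "\<dots> = (\<Sum>k\<le>Suc N. cs (coeff p k) (?x k))"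
        by (rule sum.atMost_Suc_shift[symmetric])
      also have "\<dots> = 0" by (rule Suc.prems)
      finally show ?thesis
        using Suc.IH[OF deg_q \<open>q \<noteq> 0\<close> y_in False] by blast
    qed
  qed
qed

text \<open>The iterates of \<open>x\<close> under \<open>D\<close> live in a finite-dimensional
  space, so they satisfy a real linear relation, which is read as a complex polynomial annihilating
  \<open>x\<close>.\<close>

lemma exists_eigenvector:
  assumes "invariant W D" "x \<in> W" "x \<noteq> 0"
  shows "\<exists>v\<in>W. v \<noteq> 0 \<and> (\<exists>c. D v = cs c v)"
proof -
  obtain S where S: "finite S" "span S = V"
    using finite_span by blast
  have "(D ^^ k) x \<in> span S" for k
    using invariant_funpow_in[OF assms(1,2)] S(2) assms(1) unfolding invariant_def by blast
  then obtain u :: "nat \<Rightarrow> real" and N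
    where u: "\<exists>k\<le>N. u k \<noteq> 0" "(\<Sum>k\<le>N. u k *\<^sub>R (D ^^ k) x) = 0"
    using exists_linear_relation[OF S(1), of "\<lambda>k. (D ^^ k) x"] by metis
  define p :: "complex poly" where "p = (\<Sum>k\<le>N. monom (of_real (u k)) k)"
  have coeff_p: "coeff p k = (if k \<le> N then of_real (u k) else 0)" for k
    by (simp add: p_def coeff_sum sum.delta)
  obtain k where "k \<le> N" "u k \<noteq> 0" using u(1) by blast
  then have "coeff p k \<noteq> 0" by (simp add: coeff_p)
  then have "p \<noteq> 0" by auto
  moreover have "degree p \<le> N"
    by (rule degree_le) (simp add: coeff_p)
  moreover have "(\<Sum>k\<le>N. cs (coeff p k) ((D ^^ k) x)) = 0"
  proof -
    have "(\<Sum>k\<le>N. cs (coeff p k) ((D ^^ k) x)) = (\<Sum>k\<le>N. u k *\<^sub>R (D ^^ k) x)"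
      by (intro sum.cong) (simp_all add: coeff_p)
    then show ?thesis using u(2) by simp
  qed
  ultimately show ?thesis
    using eigenvector_of_annihilating_poly[OF assms(1) _ _ assms(2,3)] by metis
qed

section \<open>Unitary families and expansions\<close>

definition unitary_family :: "(nat \<Rightarrow> 'v) \<Rightarrow> nat \<Rightarrow> bool" where
  "unitary_family e m \<longleftrightarrow> (\<forall>i<m. e i \<in> V) \<and> (\<forall>i<m. \<forall>j<m. h (e i) (e j) = of_bool (i = j))"

lemma unitary_familyD:
  assumes "unitary_family e m" "i < m"
  shows "e i \<in> V" "j < m \<Longrightarrow> h (e i) (e j) = of_bool (i = j)"
  using assms by (auto simp: unitary_family_def)

text \<open>The real orthonormal system underlying a unitary family; it translates complex dimension
  counts into \<open>dim\<close>, which is real.\<close>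

definition real_family :: "(nat \<Rightarrow> 'v) \<Rightarrow> nat \<Rightarrow> 'v set" where
  "real_family e m = e ` {..<m} \<union> (\<lambda>i. J (e i)) ` {..<m}"

lemma orthogonal_real_family:
  assumes "unitary_family e m" "x \<in> V" "\<And>i. i < m \<Longrightarrow> h x (e i) = 0" "s \<in> real_family e m"
  shows "g x s = 0"
proof -
  have "g x (e i) = 0 \<and> g x (J (e i)) = 0" if "i < m" for i
    using assms(3)[OF that] by (simp add: h_def complex_eq_iff)
  then show ?thesis using assms(4) by (auto simp: real_family_def)
qed

lemma real_family_subset: "unitary_family e m \<Longrightarrow> real_family e m \<subseteq> V"
  by (auto simp: real_family_def unitary_family_def)

text \<open>Each new \<open>e m\<close> contributes two directions: \<open>J (e m)\<close> is
  orthogonal to the earlier vectors, and \<open>e m\<close> is orthogonal to those and to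
  \<open>J (e m)\<close>.\<close>

lemma dim_real_family: "unitary_family e m \<Longrightarrow> dim (real_family e m) = 2 * m"
proof (induction m)
  case 0
  then show ?case using dim_le_card[of "{}" "{}"] by (simp add: real_family_def)
next
  case (Suc m)
  then have um: "unitary_family e m" by (simp add: unitary_family_def)
  obtain B where B: "finite B" "span B = V" using finite_span by blast
  note SV = real_family_subset[OF um]
  have e: "e m \<in> V" "h (e m) (e m) = 1" "\<And>i. i < m \<Longrightarrow> h (e m) (e i) = 0"
    using Suc.prems by (auto simp: unitary_family_def)
  then have ne: "e m \<noteq> 0" by auto
  have "J (e m) \<noteq> 0" using e ne by (metis J_J J_0 neg_equal_0_iff_equal)
  moreover have "h (J (e m)) (e i) = 0" if "i < m" for i
    using that e um by (simp add: unitary_familyD(1))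
  ultimately have 1: "J (e m) \<notin> span (real_family e m)"
    using e(1) SV orthogonal_real_family[OF um] by (intro not_in_span_if_orthogonal) simp_all
  have 2: "e m \<notin> span (insert (J (e m)) (real_family e m))"
  proof (rule not_in_span_if_orthogonal[OF e(1) ne])
    show "g (e m) s = 0" if "s \<in> insert (J (e m)) (real_family e m)" for s
      using that e(1) orthogonal_real_family[OF um e(1) e(3)] by auto
  qed (use e(1) SV in auto)
  have "real_family e (Suc m) = insert (e m) (insert (J (e m)) (real_family e m))"
    by (auto simp: real_family_def lessThan_Suc)
  then show ?case
    using Suc.IH[OF um] 1 2 dim_insert_finite_span[OF B(1)] B(2) SV e(1) by simp
qed

text \<open>The orthogonal projection of \<open>x\<close> to the complement of the complex span of
  the family.\<close>

definition residual :: "(nat \<Rightarrow> 'v) \<Rightarrow> nat \<Rightarrow> 'v \<Rightarrow> 'v" where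
  "residual e m x = x - (\<Sum>i<m. cs (h x (e i)) (e i))"

lemma residual_in: "unitary_family e m \<Longrightarrow> x \<in> V \<Longrightarrow> residual e m x \<in> V"
  by (auto simp: residual_def unitary_family_def intro!: V_closed V_sum)

lemma h_family_sum:
  assumes "unitary_family e m" "j < m"
  shows "h (\<Sum>i<m. cs (c i) (e i)) (e j) = c j"
proof -
  have "h (\<Sum>i<m. cs (c i) (e i)) (e j) = (\<Sum>i<m. if i = j then c i else 0)"
    using assms by (subst h_sum_left) (auto simp: unitary_familyD intro!: sum.cong)
  then show ?thesis using assms by simp
qed

lemma h_residual:
  assumes "unitary_family e m" "x \<in> V" "j < m"
  shows "h (residual e m x) (e j) = 0"
proof -
  have "(\<Sum>i<m. cs (h x (e i)) (e i)) \<in> V"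
    using assms by (auto simp: unitary_familyD intro!: V_sum)
  then show ?thesis
    using assms h_family_sum[OF assms(1,3), of "\<lambda>i. h x (e i)"]
    by (simp add: residual_def unitary_familyD)
qed

text \<open>The family spans only \<open>2 * m\<close> real dimensions, so some vector lies outside
  its span and has a non-zero residual.\<close>

lemma exists_orthogonal_to_family:
  assumes "unitary_family e m" "2 * m < dim V"
  shows "\<exists>v\<in>V. v \<noteq> 0 \<and> (\<forall>i<m. h v (e i) = 0)"
proof -
  have "\<not> V \<subseteq> span (real_family e m)"
  proof
    assume "V \<subseteq> span (real_family e m)"
    moreover have "finite (real_family e m)" by (simp add: real_family_def)
    ultimately have "dim V \<le> dim (span (real_family e m))"
      by (intro dim_mono_finite_span[of "real_family e m"]) auto
    then show False using assms dim_real_family[OF assms(1)] by simp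
  qed
  then obtain x where x: "x \<in> V" "x \<notin> span (real_family e m)" by blast
  have "(\<Sum>i<m. cs (h x (e i)) (e i)) \<in> span (real_family e m)"
    unfolding cs_def by (intro span_sum span_add span_scale span_base) (auto simp: real_family_def)
  then have "residual e m x \<noteq> 0"
    using x by (auto simp: residual_def)
  then show ?thesis
    using x assms residual_in h_residual by blast
qed

text \<open>A non-zero residual would be orthogonal to the family and give \<open>2 * n + 1\<close>
  dimensions inside \<open>V\<close>.\<close>

lemma unitary_expansion:
  assumes "unitary_family e n" "dim V = 2 * n" "x \<in> V"
  shows "x = (\<Sum>i<n. cs (h x (e i)) (e i))"
proof (rule ccontr)
  assume "x \<noteq> (\<Sum>i<n. cs (h x (e i)) (e i))"
  then have "residual e n x \<noteq> 0" by (simp add: residual_def)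
  then have "residual e n x \<notin> span (real_family e n)"
    using assms by (intro not_in_span_if_orthogonal)
      (auto simp: residual_in h_residual intro: orthogonal_real_family dest: real_family_subset)
  moreover obtain B where B: "finite B" "span B = V" using finite_span by blast
  ultimately have "dim (insert (residual e n x) (real_family e n)) = 2 * n + 1"
    using dim_insert_finite_span[OF B(1)] real_family_subset assms(1) dim_real_family B(2) by simp
  moreover have "dim (insert (residual e n x) (real_family e n)) \<le> dim V"
    using B(2) assms(3) residual_in[OF assms(1)] real_family_subset[OF assms(1)]
    by (intro dim_mono_finite_span[OF B(1)]) simp_all
  ultimately show False using assms(2) by simp
qed

text \<open>Ordinary polarization at \<open>u + v\<close> gives only the real part. The expression
  is complex linear in \<open>x\<close>, so replacing \<open>x\<close> by \<open>J x\<close> gives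
  the imaginary part as well.\<close>

lemma hermitian_polarization:
  assumes "invariant W D"
    and q: "\<And>y. y \<in> W \<Longrightarrow> a * g (D y) y + g (D (D y)) y + g (D y) (D y) = 0"
    and W: "x \<in> W" "y \<in> W"
  shows "of_real a * (h (D x) y + cnj (h (D y) x)) + h (D (D x)) y + cnj (h (D (D y)) x)
    + 2 * h (D x) (D y) = 0" (is "?F x y = 0")
proof -
  have DW: "D u \<in> W" "J u \<in> W" "u \<in> V" if "u \<in> W" for u
    using assms(1) that by (auto simp: invariant_def)
  have re: "Re (?F u v) = 0" if "u \<in> W" "v \<in> W" for u v
  proof -
    have uv: "u + v \<in> W" using assms(1) that by (simp add: invariant_def subspace_add)
    show ?thesis
      using q[OF uv] q[OF that(1)] q[OF that(2)] that DW g_commute[of "D u" "D v"]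
      by (simp add: invariant_add[OF assms(1)] algebra_simps)
  qed
  have "?F (J x) y = \<i> * ?F x y"
  proof -
    have "D (J u) = J (D u)" if "u \<in> W" for u
      using assms(1) that by (simp add: invariant_def)
    moreover have "h v (J u) = - \<i> * h v u" if "u \<in> W" "v \<in> W" for u v
      using h_right(2)[of u v u \<i>] that DW by simp
    ultimately show ?thesis
      using W DW by (simp add: algebra_simps)
  qed
  then have "Im (?F x y) = 0"
    using re[OF DW(2)[OF W(1)] W(2)] by simp
  then show ?thesis
    using re[OF W] by (simp only: complex_eq_iff zero_complex.sel)
qed

section \<open>Compression to an orthogonal complement and diagonalization\<close>

lemma cs_sum:
  "(\<And>i. i \<in> I \<Longrightarrow> f i \<in> V) \<Longrightarrow> cs c (sum f I) = (\<Sum>i\<in>I. cs c (f i))"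
  by (induction I rule: infinite_finite_induct) (auto simp: cs_right_add)

lemma residual_add:
  assumes "unitary_family e m" "x \<in> V" "y \<in> V"
  shows "residual e m (x + y) = residual e m x + residual e m y"
proof -
  have "(\<Sum>i<m. cs (h (x + y) (e i)) (e i)) = (\<Sum>i<m. cs (h x (e i)) (e i) + cs (h y (e i)) (e i))"
    using assms by (intro sum.cong) (auto simp: unitary_familyD cs_add)
  then show ?thesis by (simp add: residual_def sum.distrib)
qed

lemma residual_cs:
  assumes "unitary_family e m" "x \<in> V"
  shows "residual e m (cs c x) = cs c (residual e m x)"
proof -
  have "(\<Sum>i<m. cs (h (cs c x) (e i)) (e i)) = (\<Sum>i<m. cs c (cs (h x (e i)) (e i)))"
    using assms by (intro sum.cong) (auto simp: unitary_familyD)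
  also have "\<dots> = cs c (\<Sum>i<m. cs (h x (e i)) (e i))"
    using assms by (intro cs_sum[symmetric]) (auto simp: unitary_familyD)
  finally have eq: "(\<Sum>i<m. cs (h (cs c x) (e i)) (e i)) = cs c (\<Sum>i<m. cs (h x (e i)) (e i))" .
  have "(\<Sum>i<m. cs (h x (e i)) (e i)) \<in> V"
    using assms by (auto simp: unitary_familyD intro!: V_sum)
  then show ?thesis
    unfolding residual_def eq using assms(2) by (simp add: cs_def algebra_simps)
qed

text \<open>The complement of the family need not be preserved by \<open>D\<close>, but the
  compression of \<open>D\<close> to it is a complex linear endomorphism, so it has
  eigenvectors.\<close>

lemma invariant_residual:
  assumes "unitary_family e m" "invariant W D" "{v \<in> V. \<forall>i<m. h v (e i) = 0} \<subseteq> W"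
  shows "invariant {v \<in> V. \<forall>i<m. h v (e i) = 0} (\<lambda>x. residual e m (D x))"
proof -
  let ?U = "{v \<in> V. \<forall>i<m. h v (e i) = 0}"
  note e = unitary_familyD(1)[OF assms(1)]
  have DV: "D x \<in> V" "D (J x) = J (D x)" "D (r *\<^sub>R x) = r *\<^sub>R D x" if "x \<in> ?U" for x r
    using that assms(2,3) by (auto simp: invariant_def lin_on_def)
  have U: "subspace ?U" "J x \<in> ?U" if "x \<in> ?U" for x
    using that e by (auto simp: subspace_def)
  have scale: "residual e m (r *\<^sub>R x) = r *\<^sub>R residual e m x" if "x \<in> V" for r x
    using residual_cs[OF assms(1) that, of "of_real r"] by simp
  have JR: "residual e m (J x) = J (residual e m x)" if "x \<in> V" for x
    using residual_cs[OF assms(1) that, of \<i>] by simp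
  have DA: "D (x + y) = D x + D y" if "x \<in> ?U" "y \<in> ?U" for x y
    using that assms(2,3) by (intro invariant_add) auto
  show ?thesis
    unfolding invariant_def lin_on_def
    by (intro conjI ballI allI; (simp only: DV DA residual_add[OF assms(1)] scale JR)?)
      (use U e residual_in[OF assms(1)] h_residual[OF assms(1)] DV in \<open>auto simp: subspace_def\<close>)
qed

text \<open>At a unit eigenvector the identity reads
  \<open>a Re c + Re (c^2) + |c|^2 = Re c (a + 2 Re c) = 0\<close>.\<close>

lemma eigenvalue_real_part:
  assumes "v \<in> V" "g v v = 1" "D v = cs c v" "D (D v) = cs c (D v)"
    and "a * g (D v) v + g (D (D v)) v + g (D v) (D v) = 0"
  shows "Re c \<in> {0, - a / 2}"
proof -
  have "h v v = 1" using assms(1,2) by (simp add: h_self)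
  then have "h (D v) v = c" "h (D (D v)) v = c * c" "h (D v) (D v) = c * cnj c"
    using assms(1) unfolding assms(4) unfolding assms(3) by simp_all
  then have "g (D v) v = Re c" "g (D (D v)) v = Re (c * c)" "g (D v) (D v) = Re (c * cnj c)"
    by (metis Re_h)+
  then have "Re c * (a + 2 * Re c) = 0"
    using assms(5) by (simp add: algebra_simps)
  then show ?thesis by auto
qed

text \<open>The diagonalization step. Index 0 is reserved for the normal vector of \<open>W\<close>,
  so the eigenvectors already found are those of index 1 to \<open>m - 1\<close>.\<close>

lemma exists_orthogonal_eigenvector:
  assumes e: "unitary_family e m" "1 \<le> m" "2 * m < dim V"
    and W: "W = {v \<in> V. h v (e 0) = 0}" and inv: "invariant W D"
    and q: "\<And>y. y \<in> W \<Longrightarrow> a * g (D y) y + g (D (D y)) y + g (D y) (D y) = 0"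
    and eig: "\<And>i. i \<in> {1..<m} \<Longrightarrow> D (e i) = cs (z i) (e i)"
  shows "\<exists>v\<in>V. g v v = 1 \<and> (\<forall>i<m. h v (e i) = 0) \<and> (\<exists>c. D v = cs c v)"
proof -
  define U where "U = {v \<in> V. \<forall>i<m. h v (e i) = 0}"
  have UW: "U \<subseteq> W" using e(2) by (auto simp: U_def W)
  have inv_U: "invariant U (\<lambda>x. residual e m (D x))"
    unfolding U_def using e(1) inv UW by (intro invariant_residual) (auto simp: U_def)
  obtain x where "x \<in> U" "x \<noteq> 0"
    using exists_orthogonal_to_family[OF e(1,3)] by (auto simp: U_def)
  \<comment> \<open>At this point \<open>v0\<close> is an eigenvector of the compression only; the
    defect of \<open>D v\<close> is the vector \<open>w\<close> below.\<close>
  then obtain v0 c where v0: "v0 \<in> U" "v0 \<noteq> 0" "residual e m (D v0) = cs c v0"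
    using exists_eigenvector[OF inv_U] by blast
  define v where "v = cs (of_real (1 / sqrt (g v0 v0))) v0"
  have v0V: "v0 \<in> V" using v0 by (simp add: U_def)
  have "v = (1 / sqrt (g v0 v0)) *\<^sub>R v0"
    unfolding v_def by (rule cs_simps(5))
  then have "g v v = 1"
    using v0V g_pos[OF v0V v0(2)] by simp
  moreover have "v \<in> U"
    unfolding v_def by (rule invariant_cs_in[OF inv_U v0(1)])
  moreover have "residual e m (D v) = cs c v"
    unfolding v_def invariant_cs[OF inv_U v0(1)] v0(3) cs_cs[OF v0V] by (simp only: mult.commute)
  ultimately have v: "v \<in> U" "v \<in> V" "g v v = 1" "residual e m (D v) = cs c v"
    by (auto simp: U_def)
  have hvv: "h v v = 1" using v by (simp add: h_self)
  have vW: "v \<in> W" using v UW by auto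
  have eV: "e i \<in> V" if "i < m" for i using e(1) that by (rule unitary_familyD)
  have eW: "e i \<in> W" if "i \<in> {1..<m}" for i
    using that e unitary_familyD(2)[OF e(1), of i 0] by (auto simp: W eV)
  have hve: "h v (e i) = 0" "h (e i) v = 0" if "i < m" for i
    using that v eV h_commute[of "e i" v] by (auto simp: U_def)
  have DW: "D y \<in> W" "D y \<in> V" if "y \<in> W" for y
    using that inv by (auto simp: invariant_def)
  define b where "b i = h (D v) (e i)" for i
  \<comment> \<open>\<open>D v\<close> stays in \<open>W\<close>, hence is orthogonal to
    \<open>e 0\<close>. So \<open>w\<close> is a combination of eigenvectors of \<open>D\<close>,
    and \<open>D w\<close> is explicit.\<close>
  have b0: "b 0 = 0" using DW[OF vW] by (simp add: b_def W)
  define w where "w = (\<Sum>i<m. cs (b i) (e i))"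
  have w_eq: "w = (\<Sum>i\<in>{1..<m}. cs (b i) (e i))"
    unfolding w_def using b0 by (intro sum.mono_neutral_right) (auto simp: not_less_eq_eq)
  have wV: "w \<in> V" by (auto simp: w_def eV intro!: V_sum)
  have wW: "w \<in> W"
    unfolding w_eq using inv eW invariant_cs_in[OF inv] by (auto simp: invariant_def intro!: subspace_sum)
  have Dv: "D v = cs c v + w"
    using v(4) by (simp add: residual_def w_def b_def algebra_simps)
  have Dw: "D w = (\<Sum>i\<in>{1..<m}. cs (b i * z i) (e i))"
    unfolding w_eq using eW invariant_cs_in[OF inv]
    by (subst invariant_sum[OF inv]) (auto simp: invariant_cs[OF inv] eig eV intro!: sum.cong)
  have DDv: "D (D v) = cs c (D v) + D w"
    by (subst Dv) (use vW wW in \<open>simp add: invariant_add[OF inv] invariant_cs[OF inv] invariant_cs_in[OF inv]\<close>)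
  have h_sum_v: "h (\<Sum>i\<in>{1..<m}. cs (d i) (e i)) v = 0" for d
    using v(2) by (subst h_sum_left) (auto simp: hve eV)
  have hw: "h w v = 0" "h (D w) v = 0" "h v w = 0"
  proof -
    show "h w v = 0" unfolding w_eq by (rule h_sum_v)
    then show "h v w = 0" using h_commute[OF v(2) wV] by simp
    show "h (D w) v = 0" unfolding Dw by (rule h_sum_v)
  qed
  have "w = 0"
  proof (rule ccontr)
    assume "w \<noteq> 0"
    then obtain i where i: "i \<in> {1..<m}" "b i \<noteq> 0"
      unfolding w_eq by (metis (mono_tags, lifting) cs_simps(1) sum.neutral)
    then have im: "i < m" by simp
    have hDw: "h (D w) (e i) = b i * z i"
    proof -
      have "h (D w) (e i) = (\<Sum>j\<in>{1..<m}. if j = i then b j * z j else 0)"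
        unfolding Dw using eV im
        by (subst h_sum_left) (auto simp: unitary_familyD(2)[OF e(1)] intro!: sum.cong)
      then show ?thesis using i by simp
    qed
    have De: "D (e i) = cs (z i) (e i)" "D (D (e i)) = cs (z i) (D (e i))"
      using eig[OF i(1)] invariant_cs[OF inv eW[OF i(1)]] by auto
    have gee: "g (e i) (e i) = 1"
      using unitary_familyD(2)[OF e(1) im im] by (metis Re_h of_bool_eq(2) one_complex.sel(1))
    have ri: "Re (z i) \<in> {0, - a / 2}"
      using eV[OF im] gee De q[OF eW[OF i(1)]] by (rule eigenvalue_real_part)
    have "h (D (e i)) v = 0" "h (D (D (e i))) v = 0" "h (D v) (D (e i)) = cnj (z i) * b i"
        "h (D (D v)) (e i) = c * b i + b i * z i"
      using De hve[OF im] eV[OF im] v(2) DW[OF vW] DW[OF wW]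
      by (simp_all add: DDv hDw b_def)
    then have "of_real a * b i + (c * b i + b i * z i) + 2 * (cnj (z i) * b i) = 0"
      \<comment> \<open>The polarized identity at \<open>v\<close> and \<open>e i\<close>, where the
        terms \<open>h (D (e i)) v\<close> and \<open>h (D (D (e i))) v\<close> vanish.\<close>
      using hermitian_polarization[OF inv q vW eW[OF i(1)]] by (simp add: b_def)
    then have "(of_real a + c + z i + 2 * cnj (z i)) * b i = 0"
      by (simp add: algebra_simps)
    then have "of_real a + c + z i + 2 * cnj (z i) = 0" using i(2) by simp
    then have "Re (of_real a + c + z i + 2 * cnj (z i)) = 0" by simp
    then have rel: "a + Re c + 3 * Re (z i) = 0" by simp
    have "h (D v) v = c" "h (D (D v)) v = c * c" "h (D v) (D v) = c * cnj c + h w w"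
      using v(2) wV DW[OF vW] DW[OF wW] hvv hw by (simp_all add: DDv) (simp_all add: Dv hvv hw)
    then have "g (D v) v = Re c" "g (D (D v)) v = Re (c * c)" "g (D v) (D v) = Re (c * cnj c) + g w w"
      by (metis Re_h plus_complex.sel(1))+
    then have "2 * (Re c * Re c) + a * Re c + g w w = 0"
      using q[OF vW] by (simp add: algebra_simps)
    \<comment> \<open>By \<open>rel\<close>, \<open>Re c\<close> is \<open>-a\<close> if
      \<open>Re (z i) = 0\<close> and \<open>a / 2\<close> if \<open>Re (z i) = - a / 2\<close>;
      both give \<open>a * a\<close>. Then \<open>a * a + g w w = 0\<close> contradicts
      \<open>w \<noteq> 0\<close>.\<close>
    moreover have "2 * (Re c * Re c) + a * Re c = a * a"
      using ri rel by (auto simp: field_simps) algebra+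
    ultimately show False
      using g_pos[OF wV \<open>w \<noteq> 0\<close>] zero_le_square[of a] by linarith
  qed
  then show ?thesis
    using v hve Dv by (auto simp: U_def)
qed

text \<open>Induction on the length of the family, starting from \<open>X\<close> alone and
  appending one eigenvector of \<open>D\<close> at a time. At \<open>m = n\<close> the family is a
  unitary basis.\<close>

lemma exists_unitary_eigenbasis:
  assumes X: "X \<in> V" "g X X = 1" and dim: "dim V = 2 * n"
    and W: "W = {v \<in> V. h v X = 0}" and inv: "invariant W D"
    and q: "\<And>y. y \<in> W \<Longrightarrow> a * g (D y) y + g (D (D y)) y + g (D y) (D y) = 0"
    and m: "1 \<le> m" "m \<le> n"
  shows "\<exists>e z. e 0 = X \<and> unitary_family e m \<and>
    (\<forall>i\<in>{1..<m}. D (e i) = cs (z i) (e i) \<and> Re (z i) \<in> {0, - a / 2})"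
  using m
proof (induction m rule: dec_induct)
  case base
  have "unitary_family (\<lambda>_. X) 1"
    using X by (simp add: unitary_family_def h_self)
  then show ?case by (intro exI[of _ "\<lambda>_. X"]) auto
next
  case (step m)
  then obtain e z where e: "e 0 = X" "unitary_family e m"
    "\<forall>i\<in>{1..<m}. D (e i) = cs (z i) (e i) \<and> Re (z i) \<in> {0, - a / 2}"
    by auto
  have "\<exists>v\<in>V. g v v = 1 \<and> (\<forall>i<m. h v (e i) = 0) \<and> (\<exists>c. D v = cs c v)"
    using e(2) step.hyps(1) _ _ inv q
    by (rule exists_orthogonal_eigenvector) (use e step.prems dim W in auto)
  then obtain v c where v: "v \<in> V" "g v v = 1" "\<forall>i<m. h v (e i) = 0" "D v = cs c v"
    by blast
  have vW: "v \<in> W" using v e(1) step.hyps(1) by (auto simp: W)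
  have "Re c \<in> {0, - a / 2}"
    using v(1,2,4) _ q[OF vW] by (rule eigenvalue_real_part) (use v(4) invariant_cs[OF inv vW] in simp)
  moreover have "unitary_family (e(m := v)) (Suc m)"
    using e(2) v h_commute[of _ v] by (auto simp: unitary_family_def less_Suc_eq h_self)
  moreover have "(e(m := v)) 0 = X"
    using e(1) step.hyps(1) by simp
  moreover have "D ((e(m := v)) i) = cs ((z(m := d)) i) ((e(m := v)) i) \<and> Re ((z(m := d)) i) \<in> {0, - a / 2}"
    if "i \<in> {1..<Suc m}" "d = c" for i d
    using that e(3) v(4) \<open>Re c \<in> {0, - a / 2}\<close> by (cases "i = m") auto
  ultimately show ?case by blast
qed

end

text \<open>The normal is obtained by normalizing \<open>x - y\<close>, where \<open>x\<close> lies
  outside \<open>A\<close> and \<open>y\<close> is its orthogonal projection to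
  \<open>A\<close>.\<close>

lemma (in hermitian_space) exists_unit_normal:
  assumes "subspace A" "A \<subseteq> V" "dim A + 1 = dim V"
  shows "\<exists>u\<in>V. g u u = 1 \<and> A = {x \<in> V. g x u = 0}"
proof -
  obtain B where B: "finite B" "span B = V" using finite_span by blast
  obtain C where C: "C \<subseteq> A" "independent C" "A \<subseteq> span C"
    using basis_exists[of A] by metis
  have "finite C"
    using independent_span_bound[OF B(1) C(2)] C(1) assms(2) B(2) by blast
  have span_C: "span C = A"
    using C assms(1) by (simp add: span_minimal subset_antisym)
  have "A \<noteq> V" using assms(3) by auto
  then obtain x where x: "x \<in> V" "x \<notin> A" using assms(2) by blast
  obtain y where y: "y \<in> A" "\<forall>s\<in>C. g (x - y) s = 0"
    using exists_orthogonal_projection[OF \<open>finite C\<close> _ x(1)] C(1) assms(2) span_C by blast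
  define u where "u = (1 / sqrt (g (x - y) (x - y))) *\<^sub>R (x - y)"
  have xy: "x - y \<in> V" "x - y \<noteq> 0" using x y assms(2) by auto
  have "g u u = 1"
    using xy g_pos[OF xy] unfolding u_def by (simp only: V_closed g_left(2) g_right(2)) simp
  then have u: "u \<in> V" "g u u = 1"
    using xy(1) by (simp_all add: u_def)
  have "g u s = 0" if "s \<in> C" for s
  proof -
    have "s \<in> V" using that C(1) assms(2) by auto
    then show ?thesis using y(2) that xy(1) unfolding u_def by (simp only: g_left(2))
  qed
  then have Au: "g u s = 0" if "s \<in> A" for s
    using orthogonal_span[OF u(1), of C s] C(1) assms(2) span_C that by blast
  have uA: "g s u = 0" if "s \<in> A" for s
    using Au[OF that] g_commute[OF u(1), of s] that assms(2) by (metis subsetD)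
  have "u \<noteq> 0" using u by auto
  then have "u \<notin> span A"
    using Au u(1) assms(2) by (intro not_in_span_if_orthogonal)
  then have dim_u: "dim (insert u A) = dim A + 1"
    using dim_insert_finite_span[OF B(1), of A u] B(2) assms(2) by simp
  \<comment> \<open>\<open>insert u A\<close> already has the dimension of \<open>V\<close>, so a
    vector outside its span would exceed it. The coefficient of \<open>u\<close> in \<open>z\<close>
    then vanishes by orthogonality.\<close>
  have "z \<in> A" if z: "z \<in> V" "g z u = 0" for z
  proof -
    have "z \<in> span (insert u A)"
    proof (rule ccontr)
      assume "z \<notin> span (insert u A)"
      then have "dim (insert z (insert u A)) = dim V + 1"
        using dim_insert_finite_span[OF B(1), of "insert u A" z] B(2) assms(2,3) dim_u u(1) by simp
      moreover have "dim (insert z (insert u A)) \<le> dim V"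
        using dim_mono_finite_span[OF B(1), of V "insert z (insert u A)"] B(2) assms(2) u(1) z(1) by simp
      ultimately show False by simp
    qed
    then obtain k where "z - k *\<^sub>R u \<in> span A" using span_breakdown_eq by blast
    then have k: "z - k *\<^sub>R u \<in> A" using assms(1) by (metis span_eq_iff)
    then have "g (z - k *\<^sub>R u) u = 0" by (rule uA)
    then have "k = 0" using z u by simp
    then show ?thesis using k by simp
  qed
  then have "A = {x \<in> V. g x u = 0}" using uA assms(2) by blast
  then show ?thesis using u by blast
qed

subsection \<open>Almost Abelian SKT Lie algebras\<close>

locale skt_almost_abelian =
  fixes L :: "'v::real_vector herm_data" and A :: "'v set" and u :: 'v
  assumes skt: "SKT L"
    and ideal_A: "x \<in> vspace L \<Longrightarrow> y \<in> A \<Longrightarrow> bracket L x y \<in> A"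
    and abelian_A: "x \<in> A \<Longrightarrow> y \<in> A \<Longrightarrow> bracket L x y = 0"
    and u_in: "u \<in> vspace L"
    and u_unit: "metric L u u = 1"
    and A_eq: "A = {x \<in> vspace L. metric L x u = 0}"
begin

lemma ah: "almost_hermitian_lie_algebra L"
  using skt by (simp add: SKT_def)

sublocale hermitian_space "vspace L" "metric L" "acs L"
  using ah by unfold_locales (auto simp: almost_hermitian_lie_algebra_def lie_algebra_on_def)

text \<open>The sign makes \<open>acs L X = u\<close>, so that \<open>u\<close> takes the role of
  \<open>I_0X\<close> in the model.\<close>

definition "X = - acs L u"
definition "D = bracket L u"
definition "W = {v \<in> vspace L. h v X = 0}"

section \<open>The bracket in terms of \<open>D\<close>\<close>

lemma bracket_in: "x \<in> vspace L \<Longrightarrow> y \<in> vspace L \<Longrightarrow> bracket L x y \<in> vspace L"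
  using ah by (auto simp: almost_hermitian_lie_algebra_def lie_algebra_on_def)

lemma bracket_add:
  "x \<in> vspace L \<Longrightarrow> y \<in> vspace L \<Longrightarrow> z \<in> vspace L \<Longrightarrow> bracket L (x + y) z = bracket L x z + bracket L y z"
  "x \<in> vspace L \<Longrightarrow> y \<in> vspace L \<Longrightarrow> z \<in> vspace L \<Longrightarrow> bracket L z (x + y) = bracket L z x + bracket L z y"
  using ah by (auto simp: almost_hermitian_lie_algebra_def lie_algebra_on_def bilin_on_def lin_on_def)

lemma bracket_scaleR:
  "x \<in> vspace L \<Longrightarrow> y \<in> vspace L \<Longrightarrow> bracket L (r *\<^sub>R x) y = r *\<^sub>R bracket L x y"
  "x \<in> vspace L \<Longrightarrow> y \<in> vspace L \<Longrightarrow> bracket L x (r *\<^sub>R y) = r *\<^sub>R bracket L x y"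
  using ah by (auto simp: almost_hermitian_lie_algebra_def lie_algebra_on_def bilin_on_def lin_on_def)

lemma bracket_self: "x \<in> vspace L \<Longrightarrow> bracket L x x = 0"
  using ah by (auto simp: almost_hermitian_lie_algebra_def lie_algebra_on_def)

lemma bracket_flip:
  assumes "x \<in> vspace L" "y \<in> vspace L"
  shows "bracket L y x = - bracket L x y"
proof -
  have "0 = bracket L (x + y) (x + y)"
    using assms by (simp add: bracket_self)
  also have "\<dots> = bracket L y x + bracket L x y"
    using assms by (simp add: bracket_add bracket_self[OF assms(1)] bracket_self[OF assms(2)])
  finally show ?thesis by (simp add: eq_neg_iff_add_eq_0)
qed

lemma D_linear:
  "x \<in> vspace L \<Longrightarrow> y \<in> vspace L \<Longrightarrow> D (x + y) = D x + D y"
  "x \<in> vspace L \<Longrightarrow> D (r *\<^sub>R x) = r *\<^sub>R D x"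
  "D u = 0" "x \<in> vspace L \<Longrightarrow> D x \<in> vspace L"
  by (simp_all add: D_def u_in bracket_add bracket_scaleR bracket_self bracket_in)

lemma decompose:
  assumes "x \<in> vspace L"
  obtains x0 where "x0 \<in> A" "x0 \<in> vspace L" "x = x0 + metric L x u *\<^sub>R u"
proof
  show "x - metric L x u *\<^sub>R u \<in> A"
    using assms u_in u_unit by (simp add: A_eq)
  then show "x - metric L x u *\<^sub>R u \<in> vspace L" by (simp add: A_eq)
qed simp

lemma D_in_A: "x \<in> vspace L \<Longrightarrow> D x \<in> A"
proof -
  assume "x \<in> vspace L"
  then obtain x0 where x0: "x0 \<in> A" "x0 \<in> vspace L" "x = x0 + metric L x u *\<^sub>R u"
    by (rule decompose)
  have "D x = D x0"
    by (subst x0(3)) (simp add: D_linear x0(2) u_in)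
  then show "D x \<in> A" using ideal_A[OF u_in x0(1)] by (simp add: D_def)
qed

text \<open>\<open>A\<close> is Abelian, so after splitting off the components along
  \<open>u\<close> only brackets with \<open>u\<close> survive. The whole Lie algebra structure is
  thus encoded in \<open>D\<close>.\<close>

lemma bracket_eq:
  assumes "x \<in> vspace L" "y \<in> vspace L"
  shows "bracket L x y = metric L x u *\<^sub>R D y - metric L y u *\<^sub>R D x"
proof -
  obtain x0 where x0: "x0 \<in> A" "x0 \<in> vspace L" "x = x0 + metric L x u *\<^sub>R u"
    using decompose[OF assms(1)] .
  obtain y0 where y0: "y0 \<in> A" "y0 \<in> vspace L" "y = y0 + metric L y u *\<^sub>R u"
    using decompose[OF assms(2)] .
  have D: "D x = D x0" "D y = D y0"
    by (subst x0(3) y0(3), simp add: D_linear x0(2) y0(2) u_in)+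
  have "bracket L x y = bracket L (x0 + metric L x u *\<^sub>R u) (y0 + metric L y u *\<^sub>R u)"
    using x0(3) y0(3) by simp
  also have "\<dots> = metric L x u *\<^sub>R D y0 - metric L y u *\<^sub>R D x0"
    using x0(1,2) y0(1,2) u_in
    by (simp add: bracket_add bracket_scaleR bracket_self abelian_A D_def bracket_flip[of u x0])
  finally show ?thesis by (simp add: D)
qed

lemma X_props: "X \<in> vspace L" "acs L X = u" "metric L X X = 1" "metric L X u = 0" "X \<in> A"
  using u_in u_unit by (simp_all add: X_def A_eq)

lemma W_iff: "v \<in> W \<longleftrightarrow> v \<in> vspace L \<and> metric L v X = 0 \<and> metric L v u = 0"
  using X_props by (auto simp: W_def h_def complex_eq_iff)

lemma W_subset: "W \<subseteq> A" "W \<subseteq> vspace L"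
  by (auto simp: W_iff A_eq)

lemma acs_W: "v \<in> W \<Longrightarrow> acs L v \<in> W"
  using X_props(1) by (simp add: W_def)

text \<open>Integrability at \<open>X\<close> and \<open>y\<close>: the brackets of \<open>X\<close>
  with \<open>y\<close> and with \<open>acs L y\<close> vanish inside \<open>A\<close>, which leaves
  \<open>[u, Jy] = J[u, y]\<close>.\<close>

lemma D_acs: "y \<in> W \<Longrightarrow> D (acs L y) = acs L (D y)"
proof -
  assume y: "y \<in> W"
  then have yV: "y \<in> vspace L" and yA: "y \<in> A" "acs L y \<in> A"
    using W_subset acs_W by auto
  have "bracket L (acs L X) (acs L y) - acs L (bracket L (acs L X) y)
        - acs L (bracket L X (acs L y)) - bracket L X y = 0"
    using skt X_props(1) yV by (simp add: SKT_def integrable_acs_def)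
  then show ?thesis
    using abelian_A[OF X_props(5)] yA by (simp add: X_props(2) D_def)
qed

lemma invariant_W: "invariant W D"
proof -
  have "D y \<in> W" if "y \<in> W" for y
  proof -
    have yV: "y \<in> vspace L" using that W_subset by auto
    \<comment> \<open>\<open>J D y = D J y\<close> lies in \<open>A\<close>, so it is orthogonal to
      \<open>u = J X\<close>; applying the isometry \<open>J\<close> shows that \<open>D y\<close>
      is orthogonal to \<open>X\<close>.\<close>
    have "acs L (D y) \<in> A"
      using D_in_A[of "acs L y"] D_acs[OF that] yV by simp
    then have "metric L (acs L (D y)) (acs L X) = 0"
      by (simp add: A_eq X_props(2))
    then have "metric L (D y) X = 0"
      using D_linear(4)[OF yV] X_props(1) by simp
    then show ?thesis
      using D_in_A[OF yV] by (simp add: W_iff A_eq)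
  qed
  moreover have "subspace W"
    using X_props(1) by (auto simp: W_def subspace_def)
  ultimately show ?thesis
    using W_subset(2) by (auto simp: invariant_def acs_W D_acs lin_on_def D_linear subset_iff)
qed

lemma SKT_identity:
  assumes y: "y \<in> W"
  shows "metric L (D X) X * metric L (D y) y + metric L (D (D y)) y + metric L (D y) (D y) = 0"
proof -
  have V: "y \<in> vspace L" "acs L y \<in> vspace L" "D y \<in> vspace L" "D (D y) \<in> vspace L"
    "acs L (D y) \<in> vspace L" "D X \<in> vspace L" "acs L (D X) \<in> vspace L"
    using y W_subset X_props(1) by (auto simp: D_linear)
  have DyW: "D y \<in> W" using invariant_W y by (simp add: invariant_def)
  have tau: "metric L y u = 0" "metric L (acs L y) u = 0" "metric L (D y) u = 0"
    "metric L (acs L (D y)) u = 0" "metric L X u = 0"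
    "metric L (D X) u = 0"
    using y acs_W DyW acs_W[OF DyW] D_in_A X_props by (auto simp: W_iff A_eq)
  have mX: "metric L (D y) X = 0" "metric L (D (D y)) X = 0" using DyW invariant_W
    by (auto simp: invariant_def W_iff)
  \<comment> \<open>As \<open>u = J X\<close>, the \<open>u\<close>-component of
    \<open>J D X\<close> is the \<open>X\<close>-component of \<open>D X\<close>, that is, the
    constant \<open>a\<close>.\<close>
  have tauDX: "metric L (acs L (D X)) u = metric L (D X) X"
    using V X_props(1) g_J_J[of "D X" X] by (simp add: X_props(2))
  have DJ: "D (acs L y) = acs L (D y)" "D (acs L (D y)) = acs L (D (D y))"
    using D_acs y DyW by auto
  have Dm: "D (- x) = - D x" if "x \<in> vspace L" for x
    using D_linear(2)[OF that, of "-1"] by simp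
  have D0: "D 0 = 0" using D_linear(2)[OF u_in, of 0] by simp
  have "ce_d (bracket L) (pull_form (acs L) (ce_d (bracket L) (fundamental_form L))) [u, X, y, acs L y] = 0"
    using skt u_in X_props(1) V unfolding SKT_def by auto
  \<comment> \<open>All brackets are rewritten through \<open>D\<close> and components along
    \<open>u\<close>; the evaluation gives exactly twice the identity.\<close>
  then have "2 * (metric L (D X) X * metric L (D y) y + metric L (D (D y)) y + metric L (D y) (D y)) = 0"
    unfolding ce_d_4
    by (simp add: pull_d_fundamental_form[OF ah] bracket_eq u_in X_props V tau mX tauDX u_unit DJ Dm D_linear D0 algebra_simps)
  then show ?thesis by simp
qed

lemma isomorphic_g_model:
  assumes dim: "dim (vspace L) = 2 * n" and n: "1 \<le> n"
  shows "\<exists>a z w. (\<forall>i\<in>{1..<n}. Re (z i) \<in> {0, - a / 2}) \<and> ah_isomorphic L (g_model n a z w)"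
proof -
  define a where "a = metric L (D X) X"
  obtain e z where e0: "e 0 = X" and e: "unitary_family e n"
    and eig: "\<forall>i\<in>{1..<n}. D (e i) = cs (z i) (e i) \<and> Re (z i) \<in> {0, - a / 2}"
    using exists_unitary_eigenbasis[OF X_props(1,3) dim W_def invariant_W, of a n] SKT_identity n
    unfolding a_def by auto
  \<comment> \<open>The coordinates of \<open>D X = [u, X]\<close> along the eigenvectors, matching
    \<open>[I_0X, X]\<close> in the model.\<close>
  define w where "w i = h (D X) (e i)" for i
  \<comment> \<open>Unitary coordinates. Since \<open>J X = u\<close>, the number
    \<open>h x X\<close> has the components of \<open>x\<close> along \<open>X\<close> and
    \<open>u\<close> as real and imaginary parts.\<close>
  define f where "f x = (Ycomb n (\<lambda>i. h x (e i)), h x X)" for x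
  let ?M = "g_model n a z w"
  note eV = unitary_familyD(1)[OF e]
  have XV: "X \<in> vspace L" by (rule X_props)
  have coord_f: "Poly_Mapping.lookup (fst (f x)) i = (if i \<in> {1..<n} then h x (e i) else 0)"
    "snd (f x) = h x X" for x i
    by (simp_all add: f_def)
  have f_in: "f x \<in> vspace ?M" for x
    by (simp add: vspace_g_model coord_f)
  note expand = unitary_expansion[OF e dim]
  have split: "{..<n} = insert 0 {1..<n}" using n by auto
  have split_sum: "(\<Sum>i<n. F i) = F 0 + (\<Sum>i=1..<n. F i)" for F :: "nat \<Rightarrow> 'c::comm_monoid_add"
    unfolding split by simp
  have parseval: "metric ?M (f x) (f y) = metric L x y" if "x \<in> vspace L" "y \<in> vspace L" for x y
  proof -
    have "h x y = h x (\<Sum>i<n. cs (h y (e i)) (e i))"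
      using expand[OF that(2)] by simp
    also have "\<dots> = (\<Sum>i<n. cnj (h y (e i)) * h x (e i))"
      using that eV by (subst h_sum_right) auto
    finally have "Re (h x y) = (\<Sum>i<n. h x (e i) \<bullet> h y (e i))"
      by (simp add: Re_sum inner_complex_def mult.commute)
    then show ?thesis
      by (simp add: metric_g_model coord_f split_sum e0)
  qed
  have hD: "h (D y) (e i) = (if i = 0 then of_real (Re (h y X) * a) else Re (h y X) *\<^sub>R w i + z i * h y (e i))"
    if "y \<in> vspace L" "i < n" for y i
  proof -
    define y' where "y' = (\<Sum>j\<in>{1..<n}. cs (h y (e j)) (e j))"
    have eW: "e j \<in> W" if "j \<in> {1..<n}" for j
      using that eV unitary_familyD(2)[OF e, of j 0] e0 by (simp add: W_def)
    have csW: "cs c (e j) \<in> W" if "j \<in> {1..<n}" for c j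
      using invariant_cs_in[OF invariant_W eW[OF that]] .
    have y': "y' \<in> vspace L" unfolding y'_def using csW W_subset(2) by (intro V_sum) auto
    have y: "y = cs (h y X) X + y'"
      using expand[OF that(1)] by (simp add: split_sum y'_def e0)
    \<comment> \<open>The imaginary part of \<open>h y X\<close> multiplies \<open>J X = u\<close>,
      which \<open>D\<close> kills.\<close>
    have "D y = Re (h y X) *\<^sub>R D X + D y'"
      by (subst y) (simp add: cs_def XV y' X_props(2) D_linear u_in del: Re_h)
    then have "h (D y) (e i) = of_real (Re (h y X)) * h (D X) (e i) + h (D y') (e i)"
      using D_linear(4) XV y' eV[OF that(2)] by simp
    moreover have "D y' = (\<Sum>j\<in>{1..<n}. cs (z j * h y (e j)) (e j))"
      unfolding y'_def
      by (subst invariant_sum[OF invariant_W])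
        (use csW eW eV eig in \<open>auto simp: invariant_cs[OF invariant_W] mult.commute intro!: sum.cong\<close>)
    moreover have "h (\<Sum>j\<in>{1..<n}. cs (z j * h y (e j)) (e j)) (e i) = (if i = 0 then 0 else z i * h y (e i))"
    proof -
      have "h (\<Sum>j\<in>{1..<n}. cs (z j * h y (e j)) (e j)) (e i)
          = (\<Sum>j\<in>{1..<n}. if j = i then z j * h y (e j) else 0)"
        using eV that(2) by (subst h_sum_left) (auto simp: unitary_familyD(2)[OF e] intro!: sum.cong)
      then show ?thesis using that(2) by auto
    qed
    \<comment> \<open>The imaginary part is the component along \<open>u\<close>, which is zero
      because \<open>D X\<close> lies in \<open>A\<close>.\<close>
    moreover have "h (D X) X = of_real a"
      using D_in_A[OF XV] by (simp add: h_def a_def A_eq X_props(2) complex_eq_iff)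
    ultimately show ?thesis
      using e0 by (auto simp: w_def scaleR_conv_of_real simp del: Re_h)
  qed
  have hDX: "h (D y) X = of_real (Re (h y X) * a)" if "y \<in> vspace L" for y
    using hD[OF that, of 0] n e0 by simp
  have tau: "metric L x u = Im (h x X)" for x
    by (simp add: h_def X_props(2))
  have "bij_betw f (vspace L) (vspace ?M)"
  proof (rule bij_betw_imageI)
    show "inj_on f (vspace L)"
    proof (rule inj_onI)
      fix x y assume xy: "x \<in> vspace L" "y \<in> vspace L" "f x = f y"
      have "h x (e i) = h y (e i)" if "i < n" for i
        using that coord_f(1)[of x i] coord_f(1)[of y i] coord_f(2)[of x] coord_f(2)[of y] xy(3) e0 by (cases "i = 0") auto
      then show "x = y"
        using expand[OF xy(1)] expand[OF xy(2)] by simp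
    qed
    show "f ` vspace L = vspace ?M"
    proof
      show "vspace ?M \<subseteq> f ` vspace L"
      proof
        fix p assume p: "p \<in> vspace ?M"
        \<comment> \<open>Basis index 0 is \<open>X\<close>, whose complex coordinate is the second
          component of \<open>p\<close>; the other indices agree with those of the model.\<close>
        define c where "c i = (if i = 0 then snd p else Poly_Mapping.lookup (fst p) i)" for i
        define x where "x = (\<Sum>i<n. cs (c i) (e i))"
        have hx: "h x (e i) = c i" if "i < n" for i
          unfolding x_def using e that by (rule h_family_sum)
        have "f x = p"
          by (rule gvec_eqI[OF f_in p]) (use hx[of 0] n e0 in \<open>simp_all add: coord_f hx, simp_all add: c_def\<close>)
        moreover have "x \<in> vspace L"
          using eV by (auto simp: x_def intro!: V_sum)
        ultimately show "p \<in> f ` vspace L" by blast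
      qed
    qed (use f_in in auto)
  qed
  moreover have "lin_on (vspace L) f"
    unfolding lin_on_def
    by (intro conjI ballI allI gvec_eqI[of _ n a z w])
      (simp_all add: subspace_g_model subspace_add subspace_scale f_in coord_f lookup_add eV XV
        scaleR_conv_of_real)
  moreover have "f (bracket L x y) = bracket ?M (f x) (f y)" if "x \<in> vspace L" "y \<in> vspace L" for x y
    using that
    by (intro gvec_eqI[of _ n a z w])
      (simp_all add: f_in bracket_in_g_model coord_f bracket_eq D_linear(4) eV XV hD hDX tau
        scaleR_conv_of_real algebra_simps del: Re_h)
  moreover have "f (acs L x) = acs ?M (f x)" if "x \<in> vspace L" for x
    using that by (intro gvec_eqI[of _ n a z w]) (simp_all add: f_in acs_in_g_model coord_f eV XV)
  ultimately have "ah_isomorphic L ?M"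
    unfolding ah_isomorphic_def using parseval by blast
  then show ?thesis using eig by blast
qed

end

theorem theorem4p5:
  fixes n :: nat and L :: "('v::real_vector) herm_data"
  assumes "n \<ge> 1"
  shows "(SKT L \<and> almost_abelian L \<and> dim (vspace L) = 2 * n \<longrightarrow>
           (\<exists>(a::real) (z :: nat \<Rightarrow> complex) (w :: nat \<Rightarrow> complex).
              (\<forall>i\<in>{1..<n}. Re (z i) \<in> {0, - a / 2}) \<and>
              ah_isomorphic L (g_model n a z w)))
       \<and> (\<forall>(a::real) (z :: nat \<Rightarrow> complex) (w :: nat \<Rightarrow> complex).
              (\<forall>i\<in>{1..<n}. Re (z i) \<in> {0, - a / 2}) \<longrightarrow>
              SKT (g_model n a z w) \<and> almost_abelian (g_model n a z w))"
proof (intro conjI impI allI)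
  assume L: "SKT L \<and> almost_abelian L \<and> dim (vspace L) = 2 * n"
  then obtain A where A: "subspace A" "A \<subseteq> vspace L" "dim A + 1 = dim (vspace L)"
    "\<forall>x\<in>vspace L. \<forall>y\<in>A. bracket L x y \<in> A" "\<forall>x\<in>A. \<forall>y\<in>A. bracket L x y = 0"
    unfolding almost_abelian_def by blast
  interpret hermitian_space "vspace L" "metric L" "acs L"
    using L by unfold_locales
      (auto simp: SKT_def almost_hermitian_lie_algebra_def lie_algebra_on_def)
  obtain u where u: "u \<in> vspace L" "metric L u u = 1" "A = {x \<in> vspace L. metric L x u = 0}"
    using exists_unit_normal[OF A(1-3)] by blast
  interpret skt_almost_abelian L A u
    using L A(4,5) u by unfold_locales blast+
  show "\<exists>a z w. (\<forall>i\<in>{1..<n}. Re (z i) \<in> {0, - a / 2}) \<and> ah_isomorphic L (g_model n a z w)"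
    using isomorphic_g_model L assms by blast
qed (use SKT_g_model almost_abelian_g_model in blast)+

end
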